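(* Let $p>5$ be a prime with $p\equiv 3\pmod 4$, and let $k\geq 1$ be an integer. For all integers $A\geq C\geq 1$ and $B\geq D\geq 1$, $$\mathcal R(p^kA,p^kB;p^kC,p^kD)\equiv \mathcal R(p^{k-1}A,p^{k-1}B;p^{k-1}C,p^{k-1}D)\pmod{p^{3k}}.$$
   Context: For integers $A\geq C\geq 1$ and $B\geq D\geq 1$, the rectangular Gaussian binomial coefficient is the element of $\mathbb Q(i)$ $$\mathcal R(A,B;C,D):=\frac{\prod_{n=0}^{C-1}\prod_{m=0}^{D-1}\bigl(A+Bi-(n+mi)\bigr)}{\prod_{n=1}^{C}\prod_{m=1}^{D}(n+mi)}=\frac{\prod_{x=A-C+1}^{A}\prod_{y=B-D+1}^{B}(x+iy)}{\prod_{x=1}^{C}\prod_{y=1}^{D}(x+iy)}.$$ For a prime $p\equiv 3\pmod 4$, $\mathbb Q(i)$ is viewed inside $\mathbb Q_p(i)$, the unramified quadratic extension of $\mathbb Q_p$, whose ring of integers is $\mathbb Z_p[i]$. Congruences are interpreted locally: $X\equiv Y\pmod{p^r}$ means $X-Y\in p^r\mathbb Z_p[i]$. *)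

theory Defs
  imports Complex_Main "HOL-Computational_Algebra.Primes" "HOL-Algebra.QuotRing"
begin

text \<open>
  The completion \<open>\<rat>\<^sub>p\<close> of the rationals is built as Cauchy sequences modulo null sequences.
\<close>

definition padic_val :: "nat \<Rightarrow> rat \<Rightarrow> int" where
  "padic_val p q = int (multiplicity (int p) (fst (quotient_of q)))
                 - int (multiplicity (int p) (snd (quotient_of q)))"

definition padic_abs :: "nat \<Rightarrow> rat \<Rightarrow> real" where
  "padic_abs p q = (if q = 0 then 0 else real p powi (- padic_val p q))"

definition padic_Cauchy :: "nat \<Rightarrow> (nat \<Rightarrow> rat) \<Rightarrow> bool" where
  "padic_Cauchy p s \<longleftrightarrow> (\<forall>e>0. \<exists>N. \<forall>m\<ge>N. \<forall>n\<ge>N. padic_abs p (s m - s n) < e)"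

definition padic_Cauchy_ring :: "nat \<Rightarrow> (nat \<Rightarrow> rat) ring" where
  "padic_Cauchy_ring p =
     \<lparr>carrier = {s. padic_Cauchy p s},
      mult = (\<lambda>s t n. s n * t n), one = (\<lambda>n. 1),
      zero = (\<lambda>n. 0), add = (\<lambda>s t n. s n + t n)\<rparr>"

definition padic_null :: "nat \<Rightarrow> (nat \<Rightarrow> rat) set" where
  "padic_null p = {s. (\<lambda>n. padic_abs p (s n)) \<longlonglongrightarrow> 0}"

definition Qp :: "nat \<Rightarrow> (nat \<Rightarrow> rat) set ring" where
  "Qp p = padic_Cauchy_ring p Quot padic_null p"

definition Qp_of_rat :: "nat \<Rightarrow> rat \<Rightarrow> (nat \<Rightarrow> rat) set" where
  "Qp_of_rat p q = padic_null p +>\<^bsub>padic_Cauchy_ring p\<^esub> (\<lambda>n. q)"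

definition Qp_norm :: "nat \<Rightarrow> (nat \<Rightarrow> rat) set \<Rightarrow> real" where
  "Qp_norm p x = (THE l. \<forall>s\<in>x. (\<lambda>n. padic_abs p (s n)) \<longlonglongrightarrow> l)"

definition Zp :: "nat \<Rightarrow> (nat \<Rightarrow> rat) set set" where
  "Zp p = {x \<in> carrier (Qp p). Qp_norm p x \<le> 1}"

text \<open>
  The pair \<open>(u, v)\<close> stands for \<open>u + v i\<close>. This is the field obtained by adjoining a square root
  of \<open>-1\<close> when \<open>-1\<close> is not already a square, in particular for primes \<open>p \<equiv> 3 (mod 4)\<close>.
\<close>

definition Qpi :: "nat \<Rightarrow> ((nat \<Rightarrow> rat) set \<times> (nat \<Rightarrow> rat) set) ring" where
  "Qpi p =
     \<lparr>carrier = carrier (Qp p) \<times> carrier (Qp p),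
      mult = (\<lambda>(a, b) (c, d).
        ((a \<otimes>\<^bsub>Qp p\<^esub> c) \<ominus>\<^bsub>Qp p\<^esub> (b \<otimes>\<^bsub>Qp p\<^esub> d),
         (a \<otimes>\<^bsub>Qp p\<^esub> d) \<oplus>\<^bsub>Qp p\<^esub> (b \<otimes>\<^bsub>Qp p\<^esub> c))),
      one = (\<one>\<^bsub>Qp p\<^esub>, \<zero>\<^bsub>Qp p\<^esub>),
      zero = (\<zero>\<^bsub>Qp p\<^esub>, \<zero>\<^bsub>Qp p\<^esub>),
      add = (\<lambda>(a, b) (c, d). (a \<oplus>\<^bsub>Qp p\<^esub> c, b \<oplus>\<^bsub>Qp p\<^esub> d))\<rparr>"

definition Zpi :: "nat \<Rightarrow> ((nat \<Rightarrow> rat) set \<times> (nat \<Rightarrow> rat) set) set" where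
  "Zpi p = Zp p \<times> Zp p"

text \<open>
  Elements of \<open>\<rat>(i)\<close> are complex numbers with rational coordinates. The map to \<open>Qpi p\<close> is only
  meaningful on this set.
\<close>

definition gauss_rats :: "complex set" where
  "gauss_rats = {z. Re z \<in> \<rat> \<and> Im z \<in> \<rat>}"

definition Qpi_of_gauss :: "nat \<Rightarrow> complex \<Rightarrow> (nat \<Rightarrow> rat) set \<times> (nat \<Rightarrow> rat) set" where
  "Qpi_of_gauss p z =
     (Qp_of_rat p (THE q. of_rat q = Re z), Qp_of_rat p (THE q. of_rat q = Im z))"

definition gauss_cong :: "nat \<Rightarrow> nat \<Rightarrow> complex \<Rightarrow> complex \<Rightarrow> bool" where
  "gauss_cong p r X Y \<longleftrightarrow> X \<in> gauss_rats \<and> Y \<in> gauss_rats \<and>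
     Qpi_of_gauss p (X - Y) \<in> (\<lambda>z. Qpi_of_gauss p (of_nat p ^ r) \<otimes>\<^bsub>Qpi p\<^esub> z) ` Zpi p"

definition rect_gauss_binomial :: "int \<Rightarrow> int \<Rightarrow> int \<Rightarrow> int \<Rightarrow> complex" where
  "rect_gauss_binomial A B C D =
     (\<Prod>n\<in>{0..C-1}. \<Prod>m\<in>{0..D-1}.
        (of_int A + of_int B * \<i>) - (of_int n + of_int m * \<i>)) /
     (\<Prod>n\<in>{1..C}. \<Prod>m\<in>{1..D}. of_int n + of_int m * \<i>)"

lemma rect_gauss_binomial_altdef:
  "rect_gauss_binomial A B C D =
     (\<Prod>x\<in>{A-C+1..A}. \<Prod>y\<in>{B-D+1..B}. of_int x + \<i> * of_int y) /
     (\<Prod>x\<in>{1..C}. \<Prod>y\<in>{1..D}. of_int x + \<i> * of_int y)"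
proof -
  have "(\<Prod>n\<in>{0..C-1}. \<Prod>m\<in>{0..D-1}.
          (of_int A + of_int B * \<i>) - (of_int n + of_int m * \<i>)) =
        (\<Prod>x\<in>{A-C+1..A}. \<Prod>m\<in>{0..D-1}.
          (of_int A + of_int B * \<i>) - (of_int (A - x) + of_int m * \<i>))"
    by (rule prod.reindex_bij_witness[of _ "\<lambda>x. A - x" "\<lambda>n. A - n"]) auto
  also have "\<dots> = (\<Prod>x\<in>{A-C+1..A}. \<Prod>y\<in>{B-D+1..B}. of_int x + \<i> * of_int y)"
  proof (rule prod.cong)
    fix x :: int
    show "(\<Prod>m\<in>{0..D-1}. (of_int A + of_int B * \<i>) - (of_int (A - x) + of_int m * \<i>)) =
          (\<Prod>y\<in>{B-D+1..B}. of_int x + \<i> * of_int y)"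
      by (rule prod.reindex_bij_witness[of _ "\<lambda>y. B - y" "\<lambda>m. B - m"])
         (auto simp: algebra_simps)
  qed simp
  finally show ?thesis
    by (simp add: rect_gauss_binomial_def mult.commute)
qed

lemma gauss_rats_of_int: "of_int x + of_int y * \<i> \<in> gauss_rats"
  by (simp add: gauss_rats_def)

lemma gauss_rats_diff: "x \<in> gauss_rats \<Longrightarrow> y \<in> gauss_rats \<Longrightarrow> x - y \<in> gauss_rats"
  by (simp add: gauss_rats_def)

lemma gauss_rats_mult: "x \<in> gauss_rats \<Longrightarrow> y \<in> gauss_rats \<Longrightarrow> x * y \<in> gauss_rats"
  by (simp add: gauss_rats_def)

lemma gauss_rats_divide: "x \<in> gauss_rats \<Longrightarrow> y \<in> gauss_rats \<Longrightarrow> x / y \<in> gauss_rats"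
  by (simp add: gauss_rats_def Re_divide Im_divide)

lemma gauss_rats_prod: "(\<And>x. x \<in> S \<Longrightarrow> f x \<in> gauss_rats) \<Longrightarrow> prod f S \<in> gauss_rats"
  by (induction S rule: infinite_finite_induct)
     (simp_all add: gauss_rats_mult, simp_all add: gauss_rats_def)

lemma rect_gauss_binomial_in_gauss_rats: "rect_gauss_binomial A B C D \<in> gauss_rats"
  unfolding rect_gauss_binomial_def
  by (intro gauss_rats_divide gauss_rats_prod gauss_rats_diff gauss_rats_of_int)

end

theory Submission
  imports Defs "HOL-Number_Theory.Residues"
begin

text \<open>
  Put \<open>q = p\<^sup>k\<close>. Lattice points divisible by the inert prime \<open>p\<close> contribute to level \<open>k\<close> exactly a power
  of \<open>p\<close> times level \<open>k - 1\<close>, so the quotient of the two binomials is a quotient of products over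
  lattice points prime to \<open>p\<close>. Both boxes are tiled by equally many \<open>q \<times> q\<close> blocks, and translating a
  block by \<open>z \<in> q \<int>[i]\<close> multiplies its product by \<open>1 + z S\<^sub>1 + z\<^sup>2 (S\<^sub>1\<^sup>2 - S\<^sub>2) / 2\<close> modulo \<open>q\<^sup>3\<close>, where \<open>S\<^sub>j\<close> is
  the sum of the \<open>u\<^sup>-\<^sup>j\<close> over the block \<open>{1..q}\<^sup>2\<close>. The corresponding sums over the centred block vanish by the
  symmetries \<open>u \<mapsto> - u\<close> and \<open>u \<mapsto> i u\<close>. Hence \<open>S\<^sub>2\<close> is \<open>0\<close> modulo \<open>q\<close>, and moving the centred block to \<open>{1..q}\<^sup>2\<close> changes
  \<open>S\<^sub>1\<close> modulo \<open>q\<^sup>2\<close> by a multiple of \<open>q\<close> times the sum of the \<open>x\<^sup>-\<^sup>2\<close> over integers, which is again \<open>0\<close> modulo \<open>q\<close>.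
  Finally, the binomial at level \<open>k - 1\<close> is itself integral at \<open>p\<close>.
\<close>

subsection \<open>The \<open>p\<close>-adic absolute value\<close>

text \<open>Frees the valuation from the reduced fraction chosen by \<open>quotient_of\<close>: two
  fractions for the same number are cross-multiplied, and multiplicities at a prime add.\<close>

lemma padic_val_divide:
  fixes a b :: int
  assumes "prime p" "a \<noteq> 0" "b \<noteq> 0"
  shows "padic_val p (of_int a / of_int b)
    = int (multiplicity (int p) a) - int (multiplicity (int p) b)"
proof -
  obtain c d where cd: "quotient_of (of_int a / of_int b) = (c, d)"
    by fastforce
  have d: "d > 0" using quotient_of_denom_pos[OF cd] .
  have eq: "(of_int a / of_int b :: rat) = of_int c / of_int d"
    using quotient_of_div[OF cd] .
  have "(of_int (a * d) :: rat) = of_int (c * b)"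
    using eq assms d by (simp add: field_simps)
  then have e: "a * d = c * b" by (simp only: of_int_eq_iff)
  have c: "c \<noteq> 0" using e assms d by auto
  have pe: "prime_elem (int p)" using assms by simp
  have "multiplicity (int p) (a * d) = multiplicity (int p) (c * b)" by (simp only: e)
  then have "multiplicity (int p) a + multiplicity (int p) d
      = multiplicity (int p) c + multiplicity (int p) b"
    using prime_elem_multiplicity_mult_distrib[OF pe] assms c d by simp
  then show ?thesis unfolding padic_val_def cd by simp
qed

text \<open>A shared denominator lets sums as well as products be studied on integer
  numerators.\<close>

lemma rat_common_denom:
  fixes x y :: rat
  obtains a b n :: int where "n \<noteq> 0" "x = of_int a / of_int n" "y = of_int b / of_int n"
proof -
  obtain a b where 1: "quotient_of x = (a, b)" by fastforce
  obtain c d where 2: "quotient_of y = (c, d)" by fastforce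
  have p: "b > 0" "d > 0" using quotient_of_denom_pos 1 2 by auto
  show ?thesis
    by (rule that[of "b * d" "a * d" "c * b"])
       (use p quotient_of_div[OF 1] quotient_of_div[OF 2] in \<open>auto simp: field_simps\<close>)
qed

lemma padic_abs_0 [simp]: "padic_abs p 0 = 0"
  by (simp add: padic_abs_def)

lemma padic_abs_nonneg: "padic_abs p x \<ge> 0"
  by (simp add: padic_abs_def)

lemma padic_abs_mult:
  assumes "prime p"
  shows "padic_abs p (x * y) = padic_abs p x * padic_abs p y"
proof (cases "x = 0 \<or> y = 0")
  case False
  obtain a b n where n: "n \<noteq> 0" and x: "x = of_int a / of_int n" and y: "y = of_int b / of_int n"
    using rat_common_denom by blast
  have ab: "a \<noteq> 0" "b \<noteq> 0" using False x y by auto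
  have pe: "prime_elem (int p)" using assms by simp
  have xy: "x * y = of_int (a * b) / of_int (n * n)" by (simp add: x y)
  have "padic_val p (x * y) = padic_val p x + padic_val p y"
    unfolding xy unfolding x y using assms ab n
    by (simp add: padic_val_divide prime_elem_multiplicity_mult_distrib[OF pe] del: of_int_mult)
  moreover have "real p \<noteq> 0" using assms by (auto dest: prime_gt_0_nat)
  ultimately show ?thesis using False
    using power_int_add[of "real p" "- padic_val p x" "- padic_val p y"] by (simp add: padic_abs_def)
qed auto

lemma padic_abs_minus:
  assumes "prime p"
  shows "padic_abs p (- x) = padic_abs p x"
proof (cases "x = 0")
  case False
  obtain a n where n: "n \<noteq> 0" and x: "x = of_int a / of_int n"
    using rat_common_denom by blast
  have a: "a \<noteq> 0" using False x by auto
  have mx: "- x = of_int (- a) / of_int n" by (simp add: x)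
  have "padic_val p (- x) = padic_val p x"
    unfolding mx unfolding x using assms a n
    using multiplicity_times_unit_right[of "-1" "int p" a]
    by (simp add: padic_val_divide del: of_int_minus)
  then show ?thesis by (simp add: padic_abs_def)
qed simp

lemma padic_abs_diff_commute: "prime p \<Longrightarrow> padic_abs p (x - y) = padic_abs p (y - x)"
  using padic_abs_minus[of p "x - y"] by simp

lemma padic_abs_ultrametric:
  assumes "prime p"
  shows "padic_abs p (x + y) \<le> max (padic_abs p x) (padic_abs p y)"
proof (cases "x = 0 \<or> y = 0 \<or> x + y = 0")
  case True
  then show ?thesis by (auto simp: padic_abs_nonneg max.coboundedI1)
next
  case False
  obtain a b n where n: "n \<noteq> 0" and x: "x = of_int a / of_int n" and y: "y = of_int b / of_int n"
    using rat_common_denom by blast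
  have ab: "a \<noteq> 0" "b \<noteq> 0" using False x y by auto
  have xy: "x + y = of_int (a + b) / of_int n" by (simp add: x y add_divide_distrib)
  have s: "a + b \<noteq> 0" using False xy by auto
  let ?m = "\<lambda>t. multiplicity (int p) t"
  \<comment> \<open>The power of p with the smaller of the two multiplicities divides both
    numerators, hence their sum.\<close>
  have "int p ^ min (?m a) (?m b) dvd a + b"
    by (intro dvd_add multiplicity_dvd') auto
  then have "?m (a + b) \<ge> min (?m a) (?m b)"
    using s assms by (intro multiplicity_geI) auto
  then have "padic_val p (x + y) \<ge> min (padic_val p x) (padic_val p y)"
    unfolding xy unfolding x y using assms ab n s
    by (simp add: padic_val_divide del: of_int_add)
  moreover have "real p \<ge> 1" using prime_ge_1_nat[OF assms(1)] by simp
  ultimately show ?thesis using False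
    by (auto simp: padic_abs_def min_def max_def power_int_increasing split: if_splits
        intro: order_trans[rotated])
qed

lemma padic_abs_triangle:
  assumes "prime p"
  shows "padic_abs p (x + y) \<le> padic_abs p x + padic_abs p y"
  using padic_abs_ultrametric[OF assms, of x y] padic_abs_nonneg[of p x] padic_abs_nonneg[of p y]
  by linarith

lemma padic_abs_triangle_diff:
  assumes "prime p"
  shows "\<bar>padic_abs p x - padic_abs p y\<bar> \<le> padic_abs p (x - y)"
  using padic_abs_triangle[OF assms, of "x - y" y] padic_abs_triangle[OF assms, of "y - x" x]
    padic_abs_diff_commute[OF assms, of x y] by auto

lemma padic_abs_le_1:
  assumes "prime p" "\<not> int p dvd n"
  shows "padic_abs p (of_int a / of_int n) \<le> 1"
proof (cases "a = 0")
  case False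
  have "n \<noteq> 0" using assms by auto
  then have "padic_val p (of_int a / of_int n) \<ge> 0"
    using assms False by (simp add: padic_val_divide not_dvd_imp_multiplicity_0)
  moreover have "real p \<ge> 1" using prime_ge_1_nat[OF assms(1)] by simp
  ultimately have "real p powi (- padic_val p (of_int a / of_int n)) \<le> real p powi 0"
    by (intro power_int_increasing) auto
  then show ?thesis by (simp add: padic_abs_def)
qed simp

subsection \<open>The embedding of the rationals\<close>

lemma padic_CauchyD:
  assumes "padic_Cauchy p s" "e > 0"
  obtains N where "\<And>m n. m \<ge> N \<Longrightarrow> n \<ge> N \<Longrightarrow> padic_abs p (s m - s n) < e"
  using assms unfolding padic_Cauchy_def by blast

lemma padic_Cauchy_const: "padic_Cauchy p (\<lambda>n. c)"
  by (simp add: padic_Cauchy_def)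

lemma padic_Cauchy_add:
  assumes p: "prime p" and s: "padic_Cauchy p s" and t: "padic_Cauchy p t"
  shows "padic_Cauchy p (\<lambda>n. s n + t n)"
  unfolding padic_Cauchy_def
proof (intro allI impI)
  fix e :: real assume e: "e > 0"
  obtain N where N: "\<And>m n. m \<ge> N \<Longrightarrow> n \<ge> N \<Longrightarrow> padic_abs p (s m - s n) < e / 2"
    using padic_CauchyD[OF s, of "e / 2"] e by auto
  obtain M where M: "\<And>m n. m \<ge> M \<Longrightarrow> n \<ge> M \<Longrightarrow> padic_abs p (t m - t n) < e / 2"
    using padic_CauchyD[OF t, of "e / 2"] e by auto
  show "\<exists>N. \<forall>m\<ge>N. \<forall>n\<ge>N. padic_abs p (s m + t m - (s n + t n)) < e"
  proof (intro exI allI impI)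
    fix m n assume mn: "m \<ge> max N M" "n \<ge> max N M"
    have "padic_abs p ((s m - s n) + (t m - t n))
        \<le> padic_abs p (s m - s n) + padic_abs p (t m - t n)"
      by (rule padic_abs_triangle[OF p])
    then show "padic_abs p (s m + t m - (s n + t n)) < e"
      using N[of m n] M[of m n] mn by (simp add: algebra_simps)
  qed
qed

lemma padic_Cauchy_minus:
  assumes p: "prime p" and s: "padic_Cauchy p s"
  shows "padic_Cauchy p (\<lambda>n. - s n)"
proof -
  have "padic_abs p (- s m - - s n) = padic_abs p (s m - s n)" for m n
    using padic_abs_diff_commute[OF p, of "s n" "s m"] by simp
  then show ?thesis using s by (simp add: padic_Cauchy_def)
qed

lemma padic_Cauchy_bounded:
  assumes p: "prime p" and s: "padic_Cauchy p s"
  obtains N K where "K > 0" "\<And>n. n \<ge> N \<Longrightarrow> padic_abs p (s n) \<le> K"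
proof -
  obtain N where N: "\<And>m n. m \<ge> N \<Longrightarrow> n \<ge> N \<Longrightarrow> padic_abs p (s m - s n) < 1"
    using padic_CauchyD[OF s zero_less_one] by blast
  show ?thesis
  proof (rule that[of "padic_abs p (s N) + 1" N])
    fix n assume "n \<ge> N"
    then have "padic_abs p (s n - s N) < 1" using N by simp
    then show "padic_abs p (s n) \<le> padic_abs p (s N) + 1"
      using padic_abs_triangle[OF p, of "s n - s N" "s N"] by simp
  qed (use padic_abs_nonneg[of p "s N"] in simp)
qed

lemma padic_Cauchy_mult:
  assumes p: "prime p" and s: "padic_Cauchy p s" and t: "padic_Cauchy p t"
  shows "padic_Cauchy p (\<lambda>n. s n * t n)"
  unfolding padic_Cauchy_def
proof (intro allI impI)
  fix e :: real assume e: "e > 0"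
  obtain N1 K where K: "K > 0" "\<And>n. n \<ge> N1 \<Longrightarrow> padic_abs p (s n) \<le> K"
    using padic_Cauchy_bounded[OF p s] by blast
  obtain N2 L where L: "L > 0" "\<And>n. n \<ge> N2 \<Longrightarrow> padic_abs p (t n) \<le> L"
    using padic_Cauchy_bounded[OF p t] by blast
  have e1: "e / (2 * L) > 0" "e / (2 * K) > 0" using e K L by auto
  obtain N where N: "\<And>m n. m \<ge> N \<Longrightarrow> n \<ge> N \<Longrightarrow> padic_abs p (s m - s n) < e / (2 * L)"
    using padic_CauchyD[OF s e1(1)] by blast
  obtain M where M: "\<And>m n. m \<ge> M \<Longrightarrow> n \<ge> M \<Longrightarrow> padic_abs p (t m - t n) < e / (2 * K)"
    using padic_CauchyD[OF t e1(2)] by blast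
  show "\<exists>N. \<forall>m\<ge>N. \<forall>n\<ge>N. padic_abs p (s m * t m - s n * t n) < e"
  proof (intro exI allI impI)
    fix m n assume mn: "m \<ge> Max {N, M, N1, N2}" "n \<ge> Max {N, M, N1, N2}"
    have "s m * t m - s n * t n = (s m - s n) * t m + s n * (t m - t n)"
      by (simp add: algebra_simps)
    then have "padic_abs p (s m * t m - s n * t n)
        \<le> padic_abs p (s m - s n) * padic_abs p (t m) + padic_abs p (s n) * padic_abs p (t m - t n)"
      using padic_abs_triangle[OF p, of "(s m - s n) * t m" "s n * (t m - t n)"]
      by (simp add: padic_abs_mult[OF p])
    also have "\<dots> \<le> padic_abs p (s m - s n) * L + K * padic_abs p (t m - t n)"
      using mn K L by (intro add_mono mult_mono padic_abs_nonneg) auto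
    also have "\<dots> < e"
      using mn N[of m n] M[of m n] K(1) L(1) by (simp add: pos_less_divide_eq mult_ac)
    finally show "padic_abs p (s m * t m - s n * t n) < e" .
  qed
qed

lemma cring_padic_Cauchy_ring:
  assumes p: "prime p"
  shows "cring (padic_Cauchy_ring p)"
proof (rule cringI)
  show "abelian_group (padic_Cauchy_ring p)"
  proof (rule abelian_groupI)
    fix s assume s: "s \<in> carrier (padic_Cauchy_ring p)"
    show "\<exists>t\<in>carrier (padic_Cauchy_ring p). t \<oplus>\<^bsub>padic_Cauchy_ring p\<^esub> s = \<zero>\<^bsub>padic_Cauchy_ring p\<^esub>"
      using s padic_Cauchy_minus[OF p]
      by (intro bexI[of _ "\<lambda>n. - s n"]) (auto simp: padic_Cauchy_ring_def)
  qed (auto simp: padic_Cauchy_ring_def padic_Cauchy_const algebra_simps padic_Cauchy_add[OF p])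
  show "comm_monoid (padic_Cauchy_ring p)"
    by (rule comm_monoidI)
       (auto simp: padic_Cauchy_ring_def padic_Cauchy_const algebra_simps padic_Cauchy_mult[OF p])
qed (auto simp: padic_Cauchy_ring_def algebra_simps)

lemma padic_null_imp_Cauchy:
  assumes p: "prime p" and s: "s \<in> padic_null p"
  shows "padic_Cauchy p s"
  unfolding padic_Cauchy_def
proof (intro allI impI)
  fix e :: real assume e: "e > 0"
  have "(\<lambda>n. padic_abs p (s n)) \<longlonglongrightarrow> 0" using s by (simp add: padic_null_def)
  then obtain N where N: "\<And>n. n \<ge> N \<Longrightarrow> padic_abs p (s n) < e / 2"
    using LIMSEQ_D[of "\<lambda>n. padic_abs p (s n)" 0 "e / 2"] e padic_abs_nonneg by fastforce
  show "\<exists>N. \<forall>m\<ge>N. \<forall>n\<ge>N. padic_abs p (s m - s n) < e"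
  proof (intro exI allI impI)
    fix m n assume "m \<ge> N" "n \<ge> N"
    then show "padic_abs p (s m - s n) < e"
      using N[of m] N[of n] padic_abs_triangle[OF p, of "s m" "- s n"] padic_abs_minus[OF p, of "s n"]
      by simp
  qed
qed

lemma padic_null_add:
  assumes p: "prime p" and s: "s \<in> padic_null p" and t: "t \<in> padic_null p"
  shows "(\<lambda>n. s n + t n) \<in> padic_null p"
proof -
  have "(\<lambda>n. padic_abs p (s n) + padic_abs p (t n)) \<longlonglongrightarrow> 0"
    using s t unfolding padic_null_def by (auto intro: tendsto_add_zero)
  then have "(\<lambda>n. padic_abs p (s n + t n)) \<longlonglongrightarrow> 0"
    by (rule tendsto_0_le[where K = 1, OF _ always_eventually])
       (simp_all add: padic_abs_nonneg padic_abs_triangle[OF p])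
  then show ?thesis by (simp add: padic_null_def)
qed

lemma padic_null_mult:
  assumes p: "prime p" and s: "s \<in> padic_null p" and t: "padic_Cauchy p t"
  shows "(\<lambda>n. s n * t n) \<in> padic_null p"
proof -
  obtain N K where K: "K > 0" "\<And>n. n \<ge> N \<Longrightarrow> padic_abs p (t n) \<le> K"
    using padic_Cauchy_bounded[OF p t] by blast
  have "(\<lambda>n. padic_abs p (s n)) \<longlonglongrightarrow> 0"
    using s by (simp add: padic_null_def)
  moreover have "\<forall>\<^sub>F n in sequentially. norm (padic_abs p (s n * t n)) \<le> norm (padic_abs p (s n)) * K"
    using eventually_ge_at_top[of N]
    by eventually_elim (simp add: padic_abs_nonneg padic_abs_mult[OF p] mult_left_mono K)
  ultimately have "(\<lambda>n. padic_abs p (s n * t n)) \<longlonglongrightarrow> 0"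
    by (rule tendsto_0_le)
  then show ?thesis by (simp add: padic_null_def)
qed

lemma ideal_padic_null:
  assumes p: "prime p"
  shows "ideal (padic_null p) (padic_Cauchy_ring p)"
proof (rule idealI)
  interpret cring "padic_Cauchy_ring p" by (rule cring_padic_Cauchy_ring[OF p])
  show "ring (padic_Cauchy_ring p)" ..
  show "subgroup (padic_null p) (add_monoid (padic_Cauchy_ring p))"
  proof (rule add.subgroupI)
    show "padic_null p \<subseteq> carrier (padic_Cauchy_ring p)"
      using padic_null_imp_Cauchy[OF p] by (auto simp: padic_Cauchy_ring_def)
    have "(\<lambda>n. 0) \<in> padic_null p" by (simp add: padic_null_def)
    then show "padic_null p \<noteq> {}" by auto
    fix s assume s: "s \<in> padic_null p"
    have C: "padic_Cauchy p s" using padic_null_imp_Cauchy[OF p s] .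
    have "\<ominus>\<^bsub>padic_Cauchy_ring p\<^esub> s = (\<lambda>n. - s n)"
      using C padic_Cauchy_minus[OF p C]
      by (intro minus_equality) (auto simp: padic_Cauchy_ring_def)
    then show "\<ominus>\<^bsub>padic_Cauchy_ring p\<^esub> s \<in> padic_null p"
      using s by (simp add: padic_null_def padic_abs_minus[OF p])
    fix t assume "t \<in> padic_null p"
    then show "s \<oplus>\<^bsub>padic_Cauchy_ring p\<^esub> t \<in> padic_null p"
      using padic_null_add[OF p s] by (simp add: padic_Cauchy_ring_def)
  qed
  fix s t assume s: "s \<in> padic_null p" and t: "t \<in> carrier (padic_Cauchy_ring p)"
  show "s \<otimes>\<^bsub>padic_Cauchy_ring p\<^esub> t \<in> padic_null p"
    using padic_null_mult[OF p s] t by (simp add: padic_Cauchy_ring_def)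
  then show "t \<otimes>\<^bsub>padic_Cauchy_ring p\<^esub> s \<in> padic_null p"
    by (simp add: padic_Cauchy_ring_def mult.commute)
qed

section \<open>Rationals inside the quotient ring\<close>

lemma ring_Qp: "prime p \<Longrightarrow> ring (Qp p)"
  unfolding Qp_def by (rule ideal.quotient_is_ring[OF ideal_padic_null])

lemma Qp_of_rat_closed:
  assumes p: "prime p"
  shows "Qp_of_rat p x \<in> carrier (Qp p)"
proof -
  interpret ideal "padic_null p" "padic_Cauchy_ring p" by (rule ideal_padic_null[OF p])
  show ?thesis unfolding Qp_def Qp_of_rat_def
    by (rule ring_hom_closed[OF rcos_ring_hom]) (simp add: padic_Cauchy_ring_def padic_Cauchy_const)
qed

lemma Qp_of_rat_mult:
  assumes p: "prime p"
  shows "Qp_of_rat p (x * y) = Qp_of_rat p x \<otimes>\<^bsub>Qp p\<^esub> Qp_of_rat p y"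
proof -
  interpret ideal "padic_null p" "padic_Cauchy_ring p" by (rule ideal_padic_null[OF p])
  have "(\<lambda>n. x) \<in> carrier (padic_Cauchy_ring p)" "(\<lambda>n. y) \<in> carrier (padic_Cauchy_ring p)"
    by (simp_all add: padic_Cauchy_ring_def padic_Cauchy_const)
  from ring_hom_mult[OF rcos_ring_hom this] show ?thesis
    unfolding Qp_def Qp_of_rat_def by (simp add: padic_Cauchy_ring_def)
qed

lemma Qp_of_rat_0:
  assumes p: "prime p"
  shows "Qp_of_rat p 0 = \<zero>\<^bsub>Qp p\<^esub>"
proof -
  interpret ideal "padic_null p" "padic_Cauchy_ring p" by (rule ideal_padic_null[OF p])
  interpret Q: ring "padic_Cauchy_ring p Quot padic_null p" by (rule quotient_is_ring)
  show ?thesis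
    using ring_hom_zero[OF rcos_ring_hom ring_axioms Q.ring_axioms]
    unfolding Qp_def Qp_of_rat_def by (simp add: padic_Cauchy_ring_def)
qed

text \<open>\<open>Qp_norm\<close> is the common limit over all representatives. Here these are the
  constant x plus a null sequence, and the reverse triangle inequality makes the absolute values
  converge to that of x.\<close>

lemma Qp_norm_Qp_of_rat:
  assumes p: "prime p"
  shows "Qp_norm p (Qp_of_rat p x) = padic_abs p x"
proof -
  have mem: "Qp_of_rat p x = (\<lambda>s n. s n + x) ` padic_null p"
    unfolding Qp_of_rat_def a_r_coset_def' by (simp add: padic_Cauchy_ring_def image_def) blast
  have lim: "(\<lambda>n. padic_abs p (s n + x)) \<longlonglongrightarrow> padic_abs p x" if s: "s \<in> padic_null p" for s
  proof -
    have "(\<lambda>n. padic_abs p (s n)) \<longlonglongrightarrow> 0" using s by (simp add: padic_null_def)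
    moreover have "norm (padic_abs p (s n + x) - padic_abs p x) \<le> norm (padic_abs p (s n)) * 1" for n
      using padic_abs_triangle_diff[OF p, of "s n + x" x] by (simp add: padic_abs_nonneg)
    ultimately have "(\<lambda>n. padic_abs p (s n + x) - padic_abs p x) \<longlonglongrightarrow> 0"
      by (rule tendsto_0_le[OF _ always_eventually[OF allI]])
    then show ?thesis by (simp add: LIM_zero_iff)
  qed
  \<comment> \<open>The zero sequence makes the coset nonempty, which is what forces the limit in
    \<open>THE\<close> to be unique.\<close>
  have z: "(\<lambda>n. 0) \<in> padic_null p" by (simp add: padic_null_def)
  show ?thesis unfolding Qp_norm_def mem
  proof (rule the_equality)
    show "\<forall>s\<in>(\<lambda>s n. s n + x) ` padic_null p. (\<lambda>n. padic_abs p (s n)) \<longlonglongrightarrow> padic_abs p x"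
      using lim by auto
    fix l assume "\<forall>s\<in>(\<lambda>s n. s n + x) ` padic_null p. (\<lambda>n. padic_abs p (s n)) \<longlonglongrightarrow> l"
    then have "(\<lambda>n. padic_abs p (0 + x)) \<longlonglongrightarrow> l" using z by fastforce
    then show "l = padic_abs p x" by (simp add: LIMSEQ_const_iff)
  qed
qed

lemma Qpi_of_gauss_Complex:
  "Qpi_of_gauss p (Complex (of_rat x) (of_rat y)) = (Qp_of_rat p x, Qp_of_rat p y)"
  by (simp add: Qpi_of_gauss_def)

text \<open>A rational scalar has imaginary part zero, so the cross terms of the product in
  \<open>Qpi\<close> vanish and it acts on each coordinate separately.\<close>

lemma Qpi_of_gauss_scale:
  assumes p: "prime p"
  shows "Qpi_of_gauss p (Complex (of_rat (c * x)) (of_rat (c * y)))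
    = Qpi_of_gauss p (Complex (of_rat c) 0) \<otimes>\<^bsub>Qpi p\<^esub> Qpi_of_gauss p (Complex (of_rat x) (of_rat y))"
proof -
  interpret ring "Qp p" by (rule ring_Qp[OF p])
  have "Qpi_of_gauss p (Complex (of_rat c) 0) = (Qp_of_rat p c, \<zero>\<^bsub>Qp p\<^esub>)"
    using Qpi_of_gauss_Complex[of p c 0] by (simp add: Qp_of_rat_0[OF p])
  then show ?thesis
    using Qp_of_rat_closed[OF p]
    by (simp add: Qpi_of_gauss_Complex Qpi_def Qp_of_rat_mult[OF p] minus_eq)
qed

subsection \<open>Gaussian rationals integral at \<open>p\<close>\<close>

definition gauss_int :: "int \<times> int \<Rightarrow> complex" where
  "gauss_int u = Complex (of_int (fst u)) (of_int (snd u))"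

text \<open>The ring Z_(p)[i] inside the complex numbers. A single integer denominator serves both
  coordinates, so integrality is handled by rational arithmetic until the very end.\<close>

definition p_integral :: "nat \<Rightarrow> complex set" where
  "p_integral p = {z. \<exists>a b n. \<not> int p dvd n \<and> z = gauss_int (a, b) / of_int n}"

text \<open>The modulus is an integer and not an exponent of p because the congruences are taken
  modulo q, q^2 and q^3 for a power q of p.\<close>

definition p_cong :: "nat \<Rightarrow> int \<Rightarrow> complex \<Rightarrow> complex \<Rightarrow> bool" where
  "p_cong p q X Y \<longleftrightarrow> (\<exists>w\<in>p_integral p. X - Y = of_int q * w)"

text \<open>Not divisible by p in Z[i]. When p is inert, these are exactly the Gaussian integers
  invertible in \<open>p_integral p\<close>.\<close>

definition p_unit :: "nat \<Rightarrow> int \<times> int \<Rightarrow> bool" where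
  "p_unit p u \<longleftrightarrow> \<not> (int p dvd fst u \<and> int p dvd snd u)"

lemma gauss_int_eq: "gauss_int (a, b) = of_int a + \<i> * of_int b"
  by (simp add: gauss_int_def complex_eq_iff)

lemma gauss_int_eq_0_iff: "gauss_int u = 0 \<longleftrightarrow> u = (0, 0)"
  by (cases u) (simp add: gauss_int_def complex_eq_iff)

lemma p_integralI: "\<not> int p dvd n \<Longrightarrow> gauss_int (a, b) / of_int n \<in> p_integral p"
  unfolding p_integral_def by blast

lemma p_cong_diffI: "w \<in> p_integral p \<Longrightarrow> X - Y = of_int q * w \<Longrightarrow> p_cong p q X Y"
  unfolding p_cong_def by blast

section \<open>The local ring at an inert prime\<close>

locale inert_prime =
  fixes p :: nat
  assumes prime_p: "prime p" and p_mod_4: "p mod 4 = 3"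
begin

lemma p_pos: "p > 0"
  using prime_p by (rule prime_gt_0_nat)

lemma prime_int_p: "prime (int p)"
  using prime_p by simp

lemma not_dvd_2: "\<not> int p dvd 2"
proof
  assume "int p dvd 2"
  then have "p \<le> 2" using zdvd_imp_le by fastforce
  then show False using p_mod_4 by presburger
qed

lemma gauss_int_in: "gauss_int u \<in> p_integral p"
proof -
  have "\<not> int p dvd 1" using prime_int_p not_prime_unit by blast
  from p_integralI[OF this, of "fst u" "snd u"] show ?thesis by simp
qed

lemma of_int_in: "of_int n \<in> p_integral p"
  using gauss_int_in[of "(n, 0)"] by (simp add: gauss_int_eq)

lemma zero_in: "0 \<in> p_integral p" and one_in: "1 \<in> p_integral p"
  using of_int_in[of 0] of_int_in[of 1] by auto

lemma i_in: "\<i> \<in> p_integral p"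
  using gauss_int_in[of "(0, 1)"] by (simp add: gauss_int_eq)

lemma add_in:
  assumes "x \<in> p_integral p" "y \<in> p_integral p"
  shows "x + y \<in> p_integral p"
proof -
  obtain a b n where x: "\<not> int p dvd n" "x = gauss_int (a, b) / of_int n"
    using assms(1) unfolding p_integral_def by blast
  obtain c d m where y: "\<not> int p dvd m" "y = gauss_int (c, d) / of_int m"
    using assms(2) unfolding p_integral_def by blast
  have nm: "n \<noteq> 0" "m \<noteq> 0" using x y by auto
  have "x + y = gauss_int (a * m + c * n, b * m + d * n) / of_int (n * m)"
    using nm by (simp add: x y gauss_int_eq field_simps)
  moreover have "\<not> int p dvd n * m"
    using x y prime_int_p by (simp add: prime_dvd_mult_iff)
  ultimately show ?thesis by (metis p_integralI)
qed

lemma mult_in: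
  assumes "x \<in> p_integral p" "y \<in> p_integral p"
  shows "x * y \<in> p_integral p"
proof -
  obtain a b n where x: "\<not> int p dvd n" "x = gauss_int (a, b) / of_int n"
    using assms(1) unfolding p_integral_def by blast
  obtain c d m where y: "\<not> int p dvd m" "y = gauss_int (c, d) / of_int m"
    using assms(2) unfolding p_integral_def by blast
  have nm: "n \<noteq> 0" "m \<noteq> 0" using x y by auto
  have "gauss_int (a, b) * gauss_int (c, d) = gauss_int (a * c - b * d, a * d + b * c)"
    by (simp add: gauss_int_def complex_eq_iff)
  then have "x * y = gauss_int (a * c - b * d, a * d + b * c) / of_int (n * m)"
    by (simp add: x y)
  moreover have "\<not> int p dvd n * m"
    using x y prime_int_p by (simp add: prime_dvd_mult_iff)
  ultimately show ?thesis by (metis p_integralI)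
qed

lemma minus_in: "x \<in> p_integral p \<Longrightarrow> - x \<in> p_integral p"
  using mult_in[OF of_int_in[of "-1"]] by simp

lemma diff_in: "x \<in> p_integral p \<Longrightarrow> y \<in> p_integral p \<Longrightarrow> x - y \<in> p_integral p"
  using add_in[OF _ minus_in, of x y] by simp

lemma power_in: "x \<in> p_integral p \<Longrightarrow> x ^ n \<in> p_integral p"
  by (induction n) (auto simp: one_in mult_in)

lemma sum_in: "(\<And>x. x \<in> A \<Longrightarrow> f x \<in> p_integral p) \<Longrightarrow> sum f A \<in> p_integral p"
  by (induction A rule: infinite_finite_induct) (auto simp: zero_in add_in)

lemma prod_in: "(\<And>x. x \<in> A \<Longrightarrow> f x \<in> p_integral p) \<Longrightarrow> prod f A \<in> p_integral p"
  by (induction A rule: infinite_finite_induct) (auto simp: one_in mult_in)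

lemma inverse_of_int_in:
  assumes "\<not> int p dvd n"
  shows "inverse (of_int n) \<in> p_integral p"
  using p_integralI[OF assms, of 1 0] by (simp add: gauss_int_eq inverse_eq_divide)

text \<open>This is where inertness enters: -1 is not a square modulo p. Raising x^2 = -y^2 to the
  odd power (p - 1)/2 and applying Fermat would give 1 = -1 modulo p.\<close>

lemma not_dvd_sum_squares:
  fixes x y :: int
  assumes "\<not> (int p dvd x \<and> int p dvd y)"
  shows "\<not> int p dvd x ^ 2 + y ^ 2"
proof
  assume dvd: "int p dvd x ^ 2 + y ^ 2"
  have y: "\<not> int p dvd y"
  proof
    assume "int p dvd y"
    then have "int p dvd y ^ 2" by (simp add: power2_eq_square)
    then have "int p dvd x ^ 2" using dvd by (simp add: dvd_add_left_iff)
    then have "int p dvd x" using prime_int_p prime_dvd_power by blast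
    then show False using assms \<open>int p dvd y\<close> by simp
  qed
  have x: "\<not> int p dvd x"
  proof
    assume "int p dvd x"
    then have "int p dvd x ^ 2" by (simp add: power2_eq_square)
    then have "int p dvd y ^ 2" using dvd by (simp add: dvd_add_right_iff)
    then show False using y prime_int_p prime_dvd_power by blast
  qed
  \<comment> \<open>Fermat's theorem is available for naturals, so it is applied to the absolute
    value of z; the even exponent then removes the sign.\<close>
  have fermat: "[z ^ (p - 1) = 1] (mod int p)" if "\<not> int p dvd z" for z :: int
  proof -
    have "\<not> p dvd nat \<bar>z\<bar>" using that by (simp flip: int_dvd_int_iff)
    then have "[nat \<bar>z\<bar> ^ (p - 1) = 1] (mod p)" using fermat_theorem prime_p by blast
    then have "[\<bar>z\<bar> ^ (p - 1) = 1] (mod int p)"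
      by (simp flip: cong_int_iff)
    moreover have "even (p - 1)" using p_mod_4 by presburger
    ultimately show ?thesis by (simp add: power_even_abs)
  qed
  define m where "m = (p - 1) div 2"
  have m: "p - 1 = 2 * m" "odd m" using p_mod_4 unfolding m_def by presburger+
  have "[x ^ 2 = - (y ^ 2)] (mod int p)"
    using dvd by (simp add: cong_iff_dvd_diff)
  then have "[(x ^ 2) ^ m = (- (y ^ 2)) ^ m] (mod int p)" by (rule cong_pow)
  then have "[x ^ (p - 1) = - (y ^ (p - 1))] (mod int p)"
    using m by (simp add: power_mult)
  moreover have "[- (y ^ (p - 1)) = - 1] (mod int p)"
    using fermat[OF y] by (simp add: cong_minus_minus_iff)
  ultimately have "[1 = - 1] (mod int p)"
    using fermat[OF x] by (meson cong_sym cong_trans)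
  then have "int p dvd 2" by (simp add: cong_iff_dvd_diff)
  then show False using not_dvd_2 by contradiction
qed

lemma gauss_int_unit_nonzero: "p_unit p u \<Longrightarrow> gauss_int u \<noteq> 0"
  by (auto simp: p_unit_def gauss_int_eq_0_iff)

text \<open>The inverse is the conjugate divided by the norm x^2 + y^2, and the norm is prime to
  p.\<close>

lemma inverse_gauss_int_in:
  assumes "p_unit p u"
  shows "inverse (gauss_int u) \<in> p_integral p"
proof -
  obtain x y where u: "u = (x, y)" by fastforce
  have nd: "\<not> int p dvd x ^ 2 + y ^ 2"
    using assms not_dvd_sum_squares by (simp add: p_unit_def u)
  have "gauss_int (x, y) * gauss_int (x, - y) = of_int (x ^ 2 + y ^ 2)"
    by (simp add: gauss_int_def complex_eq_iff power2_eq_square)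
  moreover have "of_int (x ^ 2 + y ^ 2) \<noteq> (0::complex)" using nd by (metis dvd_0_right of_int_eq_0_iff)
  ultimately have "inverse (gauss_int u) = gauss_int (x, - y) / of_int (x ^ 2 + y ^ 2)"
    using gauss_int_unit_nonzero[OF assms] unfolding u by (simp add: field_simps del: of_int_add of_int_power)
  then show ?thesis using p_integralI[OF nd] by metis
qed

lemma half_in:
  assumes "x \<in> p_integral p"
  shows "x / 2 \<in> p_integral p"
  using mult_in[OF assms inverse_of_int_in[OF not_dvd_2]] by (metis divide_inverse of_int_numeral)

section \<open>Congruences in the local ring\<close>

lemma p_cong_refl: "p_cong p q x x"
  using p_cong_diffI[OF zero_in, of x x] by simp

lemma p_cong_sym: "p_cong p q x y \<Longrightarrow> p_cong p q y x"
  unfolding p_cong_def by (metis minus_in minus_diff_eq mult_minus_right)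

lemma p_cong_trans: "p_cong p q x y \<Longrightarrow> p_cong p q y z \<Longrightarrow> p_cong p q x z"
  unfolding p_cong_def by (metis add_in diff_add_cancel add_diff_eq distrib_left)

lemma p_cong_add: "p_cong p q x y \<Longrightarrow> p_cong p q x' y' \<Longrightarrow> p_cong p q (x + x') (y + y')"
  unfolding p_cong_def by (metis add_in add_diff_add distrib_left)

lemma p_cong_mult:
  assumes "p_cong p q x y" "p_cong p q x' y'" "x' \<in> p_integral p" "y \<in> p_integral p"
  shows "p_cong p q (x * x') (y * y')"
proof -
  obtain w w' where w: "w \<in> p_integral p" "x - y = of_int q * w"
    and w': "w' \<in> p_integral p" "x' - y' = of_int q * w'"
    using assms(1,2) unfolding p_cong_def by blast
  have "x * x' - y * y' = (x - y) * x' + y * (x' - y')" by (simp add: algebra_simps)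
  also have "\<dots> = of_int q * (w * x' + y * w')" by (simp add: w w' algebra_simps)
  finally show ?thesis using w w' assms by (intro p_cong_diffI[of "w * x' + y * w'"] add_in mult_in)
qed

lemma p_cong_sum: "(\<And>x. x \<in> A \<Longrightarrow> p_cong p q (f x) (g x)) \<Longrightarrow> p_cong p q (sum f A) (sum g A)"
  by (induction A rule: infinite_finite_induct) (auto simp: p_cong_refl p_cong_add)

lemma p_cong_prod:
  assumes "\<And>x. x \<in> A \<Longrightarrow> p_cong p q (f x) (g x)"
    and "\<And>x. x \<in> A \<Longrightarrow> f x \<in> p_integral p" "\<And>x. x \<in> A \<Longrightarrow> g x \<in> p_integral p"
  shows "p_cong p q (prod f A) (prod g A)"
  using assms
proof (induction A rule: infinite_finite_induct)
  case (insert x A)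
  then show ?case by (simp add: p_cong_mult prod_in)
qed (simp_all add: p_cong_refl)

lemma p_cong_inverse:
  assumes "p_cong p q x y" "inverse x \<in> p_integral p" "inverse y \<in> p_integral p" "x \<noteq> 0" "y \<noteq> 0"
  shows "p_cong p q (inverse x) (inverse y)"
proof -
  obtain w where w: "w \<in> p_integral p" "x - y = of_int q * w"
    using assms(1) unfolding p_cong_def by blast
  have "inverse x - inverse y = of_int q * (- w * inverse x * inverse y)"
    using assms(4,5) w(2) by (simp add: field_simps)
  then show ?thesis using w assms by (intro p_cong_diffI[of "- w * inverse x * inverse y"] mult_in minus_in)
qed

end

subsection \<open>Sums and products over a complete residue system\<close>

text \<open>The representatives 1, ..., q, and not 0, ..., q - 1, match the products in the
  binomial, which start at 1.\<close>

definition unit_box :: "nat \<Rightarrow> int \<Rightarrow> (int \<times> int) set" where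
  "unit_box p q = {u \<in> {0<..q} \<times> {0<..q}. p_unit p u}"

text \<open>For q = 2 h + 1 this represents the same residues modulo q as
  \<open>unit_box p q\<close>, but is stable under negation and under multiplication by i.\<close>

definition centered_box :: "nat \<Rightarrow> int \<Rightarrow> (int \<times> int) set" where
  "centered_box p h = {u \<in> {-h..h} \<times> {-h..h}. p_unit p u}"

lemma finite_unit_box [simp]: "finite (unit_box p q)"
  by (rule finite_subset[of _ "{0<..q} \<times> {0<..q}"]) (auto simp: unit_box_def)

lemma sum_centered_box_uminus:
  "(\<Sum>u\<in>centered_box p h. f (- fst u, - snd u)) = (\<Sum>u\<in>centered_box p h. f u)"
  by (rule sum.reindex_bij_witness[of _ "\<lambda>u. (- fst u, - snd u)" "\<lambda>u. (- fst u, - snd u)"])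
     (auto simp: centered_box_def p_unit_def)

lemma sum_centered_box_rotate:
  "(\<Sum>u\<in>centered_box p h. f (- snd u, fst u)) = (\<Sum>u\<in>centered_box p h. f u)"
  by (rule sum.reindex_bij_witness[of _ "\<lambda>u. (snd u, - fst u)" "\<lambda>u. (- snd u, fst u)"])
     (auto simp: centered_box_def p_unit_def)

lemma gauss_int_uminus: "gauss_int (- fst u, - snd u) = - gauss_int u"
  by (simp add: gauss_int_def complex_eq_iff)

lemma gauss_int_rotate: "gauss_int (- snd u, fst u) = \<i> * gauss_int u"
  by (simp add: gauss_int_def complex_eq_iff)

lemma sum_inverse_centered_box: "(\<Sum>u\<in>centered_box p h. inverse (gauss_int u)) = 0"
  using sum_centered_box_uminus[of "\<lambda>u. inverse (gauss_int u)" p h]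
  by (simp add: gauss_int_uminus sum_negf)

text \<open>Multiplying u by i multiplies u^-2 by -1, so the sum equals its own negative.\<close>

lemma sum_inverse_square_centered_box: "(\<Sum>u\<in>centered_box p h. inverse (gauss_int u) ^ 2) = 0"
  using sum_centered_box_rotate[of "\<lambda>u. inverse (gauss_int u) ^ 2" p h]
  by (simp add: gauss_int_rotate power_mult_distrib sum_negf)

text \<open>Translating \<open>u\<close> by \<open>q\<close> times this element moves the centred box onto \<open>{0<..q} \<times> {0<..q}\<close>.\<close>
definition box_shift :: "int \<times> int \<Rightarrow> complex" where
  "box_shift u = gauss_int (of_bool (fst u \<le> 0), of_bool (snd u \<le> 0))"

text \<open>Pairing u with -u replaces the shift by the constant 1 + i, except for an extra 1 or i
  on the axes. The constant part meets a vanishing sum, so only sums over the two axes, that is over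
  ordinary integers, survive.\<close>

lemma sum_box_shift_inverse_square:
  "2 * (\<Sum>u\<in>centered_box p h. box_shift u * inverse (gauss_int u) ^ 2)
    = (\<i> - 1) * (\<Sum>x | x \<in> {-h..h} \<and> \<not> int p dvd x. inverse (of_int x) ^ 2)"
proof -
  let ?B = "centered_box p h"
  let ?s = "\<lambda>u. inverse (gauss_int u) ^ 2"
  let ?T = "\<Sum>x | x \<in> {-h..h} \<and> \<not> int p dvd x. inverse (of_int x :: complex) ^ 2"
  have fin: "finite ?B"
    by (rule finite_subset[of _ "{-h..h} \<times> {-h..h}"]) (auto simp: centered_box_def)
  have real_axis: "(\<Sum>u\<in>?B. of_bool (snd u = 0) * ?s u) = ?T"
  proof -
    have "(\<Sum>u\<in>?B. of_bool (snd u = 0) * ?s u) = (\<Sum>u | u \<in> ?B \<and> snd u = 0. ?s u)"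
      by (rule sum.mono_neutral_cong_right) (use fin in auto)
    also have "\<dots> = ?T"
      by (rule sum.reindex_bij_witness[of _ "\<lambda>x. (x, 0)" fst])
         (auto simp: centered_box_def p_unit_def gauss_int_eq)
    finally show ?thesis .
  qed
  \<comment> \<open>Multiplication by i exchanges the axes and changes the sign of u^-2.\<close>
  have imag_axis: "(\<Sum>u\<in>?B. of_bool (fst u = 0) * ?s u) = - ?T"
    using sum_centered_box_rotate[of "\<lambda>u. of_bool (fst u = 0) * ?s u" p h] real_axis
    by (simp add: gauss_int_rotate power_mult_distrib sum_negf)
  have shift: "box_shift u + box_shift (- fst u, - snd u)
      = (1 + \<i>) + of_bool (fst u = 0) + \<i> * of_bool (snd u = 0)" for u
    by (auto simp: box_shift_def gauss_int_eq)
  have "2 * (\<Sum>u\<in>?B. box_shift u * ?s u)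
      = (\<Sum>u\<in>?B. box_shift u * ?s u) + (\<Sum>u\<in>?B. box_shift (- fst u, - snd u) * ?s u)"
    using sum_centered_box_uminus[of "\<lambda>u. box_shift u * ?s u" p h]
    by (simp add: gauss_int_uminus)
  also have "\<dots> = (\<Sum>u\<in>?B. (box_shift u + box_shift (- fst u, - snd u)) * ?s u)"
    by (simp add: sum.distrib distrib_right)
  also have "\<dots> = (1 + \<i>) * (\<Sum>u\<in>?B. ?s u) + (\<Sum>u\<in>?B. of_bool (fst u = 0) * ?s u)
      + \<i> * (\<Sum>u\<in>?B. of_bool (snd u = 0) * ?s u)"
    by (simp only: shift distrib_right sum.distrib sum_distrib_left mult.assoc)
  also have "\<dots> = (\<i> - 1) * ?T"
    by (simp only: sum_inverse_square_centered_box real_axis imag_axis) (simp add: algebra_simps)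
  finally show ?thesis .
qed

text \<open>Coordinates above h move down by q, and nonpositive ones move back up. As p divides q,
  this preserves being prime to p.\<close>

lemma sum_unit_box_centered:
  fixes f :: "complex \<Rightarrow> complex"
  assumes q: "q = 2 * h + 1" "int p dvd q"
  shows "(\<Sum>u\<in>unit_box p q. f (gauss_int u))
    = (\<Sum>u\<in>centered_box p h. f (gauss_int u + of_int q * box_shift u))"
proof (rule sum.reindex_bij_witness[where
    i = "\<lambda>u. (fst u + q * of_bool (fst u \<le> 0), snd u + q * of_bool (snd u \<le> 0))" and
    j = "\<lambda>u. (fst u - q * of_bool (fst u > h), snd u - q * of_bool (snd u > h))"])
  fix u
  have "int p dvd x - q \<longleftrightarrow> int p dvd x" "int p dvd x + q \<longleftrightarrow> int p dvd x" for x
    using q(2) by (auto simp: dvd_diff_left_iff dvd_add_left_iff)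
  \<comment> \<open>The second copy is for goals in which simplification with \<open>q(1)\<close>
    has replaced \<open>q\<close> by \<open>2 * h + 1\<close>.\<close>
  note d = this this[unfolded q(1)]
  {
    assume u: "u \<in> unit_box p q"
    show "(fst u - q * of_bool (fst u > h), snd u - q * of_bool (snd u > h)) \<in> centered_box p h"
      using u q(1) by (auto simp: unit_box_def centered_box_def p_unit_def d)
    show "f (gauss_int (fst u - q * of_bool (fst u > h), snd u - q * of_bool (snd u > h)) +
        of_int q * box_shift (fst u - q * of_bool (fst u > h), snd u - q * of_bool (snd u > h)))
        = f (gauss_int u)"
      using u q(1) by (cases u) (auto simp: unit_box_def box_shift_def gauss_int_eq algebra_simps)
  }
  {
    assume u: "u \<in> centered_box p h"
    show "(fst u + q * of_bool (fst u \<le> 0), snd u + q * of_bool (snd u \<le> 0)) \<in> unit_box p q"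
      using u q(1) by (auto simp: unit_box_def centered_box_def p_unit_def d)
  }
qed (use q(1) in \<open>auto simp: unit_box_def centered_box_def\<close>)

context inert_prime
begin

lemma box_shift_in: "box_shift u \<in> p_integral p"
  by (simp add: box_shift_def gauss_int_in)

lemma p_unit_cong:
  assumes "p_unit p (x, y)" "int p dvd q"
  shows "p_unit p (x + q * a, y + q * b)"
  using assms by (simp add: p_unit_def dvd_add_left_iff)

lemma translate_unit:
  assumes "p_unit p u" "int p dvd q"
  shows "gauss_int u + of_int q * gauss_int v \<noteq> 0"
    and "inverse (gauss_int u + of_int q * gauss_int v) \<in> p_integral p"
proof -
  have "gauss_int u + of_int q * gauss_int v = gauss_int (fst u + q * fst v, snd u + q * snd v)"
    by (simp add: gauss_int_def complex_eq_iff)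
  moreover have "p_unit p (fst u + q * fst v, snd u + q * snd v)"
    using p_unit_cong assms by simp
  ultimately show "gauss_int u + of_int q * gauss_int v \<noteq> 0"
    "inverse (gauss_int u + of_int q * gauss_int v) \<in> p_integral p"
    using gauss_int_unit_nonzero inverse_gauss_int_in by metis+
qed

lemma p_cong_inverse_of_int:
  assumes "[x = y] (mod q)" "\<not> int p dvd x" "\<not> int p dvd y"
  shows "p_cong p q (inverse (of_int x)) (inverse (of_int y))"
proof -
  obtain m where "x - y = q * m" using assms(1) by (auto simp: cong_iff_dvd_diff)
  then have "of_int x - of_int y = (of_int q * of_int m :: complex)"
    by (metis of_int_diff of_int_mult)
  then have "p_cong p q (of_int x) (of_int y)" by (rule p_cong_diffI[OF of_int_in])
  moreover have "x \<noteq> 0" "y \<noteq> 0" using assms by auto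
  ultimately show ?thesis using p_cong_inverse inverse_of_int_in assms by simp
qed

lemma p_cong_power2:
  "p_cong p q x y \<Longrightarrow> x \<in> p_integral p \<Longrightarrow> y \<in> p_integral p \<Longrightarrow> p_cong p q (x ^ 2) (y ^ 2)"
  by (simp add: power2_eq_square p_cong_mult)

text \<open>Doubling permutes the units modulo \<open>q\<close>, so four times the sum is congruent to the sum.\<close>
lemma sum_inverse_squares:
  assumes q: "q = 2 * h + 1" "int p dvd q" "h \<ge> 0" and p3: "p \<noteq> 3"
    and coprime: "\<And>x. q dvd 2 * x \<Longrightarrow> q dvd x"
  shows "p_cong p q (\<Sum>x | x \<in> {-h..h} \<and> \<not> int p dvd x. inverse (of_int x) ^ 2) 0"
proof -
  let ?V = "{x. x \<in> {-h..h} \<and> \<not> int p dvd x}"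
  let ?f = "\<lambda>x::int. inverse (of_int x :: complex) ^ 2"
  \<comment> \<open>The representative of 2 x modulo q in the interval from -h to h: adding h before
    the reduction and subtracting it afterwards centres the residues.\<close>
  define g where "g x = (2 * x + h) mod q - h" for x
  have fin: "finite ?V" by (rule finite_subset[of _ "{-h..h}"]) auto
  have cong_g: "[g x = 2 * x] (mod q)" for x
    unfolding g_def by (simp add: cong_iff_dvd_diff mod_eq_dvd_iff[symmetric] mod_diff_left_eq)
  have range_g: "g x \<in> {-h..h}" for x
    using pos_mod_bound[of q "2 * x + h"] pos_mod_sign[of q "2 * x + h"] q by (auto simp: g_def)
  have unit_g: "\<not> int p dvd g x" if "\<not> int p dvd x" for x
  proof -
    have "[g x = 2 * x] (mod int p)" using cong_g q(2) cong_dvd_modulus by blast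
    then have "int p dvd g x \<longleftrightarrow> int p dvd 2 * x" by (rule cong_dvd_iff)
    then show ?thesis using that not_dvd_2 prime_int_p by (simp add: prime_dvd_mult_iff)
  qed
  have inj: "inj_on g ?V"
  proof (rule inj_onI)
    fix x y assume xy: "x \<in> ?V" "y \<in> ?V" "g x = g y"
    then have "[2 * x = 2 * y] (mod q)" using cong_g by (metis cong_sym cong_trans)
    \<comment> \<open>The factor 2 is cancelled modulo q by \<open>coprime\<close>; two points of
      the centred interval differ by at most 2 h < q.\<close>
    then have "q dvd x - y" using coprime[of "x - y"] by (simp add: cong_iff_dvd_diff algebra_simps)
    moreover have "\<bar>x - y\<bar> < q" using xy q by auto
    ultimately show "x = y" using dvd_imp_le_int[of "x - y" q] by auto
  qed
  have "g ` ?V \<subseteq> ?V" using range_g unit_g by auto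
  then have "g ` ?V = ?V" using endo_inj_surj[OF fin _ inj] by blast
  then have "(\<Sum>x\<in>?V. ?f x) = (\<Sum>x\<in>?V. ?f (g x))"
    using sum.reindex[OF inj, of ?f] by simp
  moreover have "p_cong p q (\<Sum>x\<in>?V. ?f (g x)) (\<Sum>x\<in>?V. ?f (2 * x))"
  proof (rule p_cong_sum)
    fix x assume "x \<in> ?V"
    then have "\<not> int p dvd g x" "\<not> int p dvd 2 * x"
      using unit_g not_dvd_2 prime_int_p by (auto simp: prime_dvd_mult_iff)
    then show "p_cong p q (?f (g x)) (?f (2 * x))"
      using cong_g by (intro p_cong_power2 p_cong_inverse_of_int inverse_of_int_in)
  qed
  moreover have "(\<Sum>x\<in>?V. ?f (2 * x)) = (\<Sum>x\<in>?V. ?f x) / 4"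
    by (simp add: sum_divide_distrib power_mult_distrib power2_eq_square field_simps)
  ultimately have "p_cong p q (\<Sum>x\<in>?V. ?f x) ((\<Sum>x\<in>?V. ?f x) / 4)" by metis
  then obtain w where w: "w \<in> p_integral p"
    "(\<Sum>x\<in>?V. ?f x) - (\<Sum>x\<in>?V. ?f x) / 4 = of_int q * w"
    unfolding p_cong_def by blast
  \<comment> \<open>If T is the sum, then T - T/4 = q w yields T = q (4 w / 3), so 3 has to be
    invertible at p.\<close>
  have eq: "(\<Sum>x\<in>?V. ?f x) - 0 = of_int q * (of_int 4 * w * inverse (of_int 3))"
    using w(2) by (simp add: field_simps)
  have "\<not> int p dvd 3"
  proof
    assume "int p dvd 3"
    then have "p \<le> 3" using zdvd_imp_le by fastforce
    then show False using p_mod_4 p3 by presburger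
  qed
  then show ?thesis
    using w(1) by (intro p_cong_diffI[OF _ eq] mult_in of_int_in inverse_of_int_in)
qed

text \<open>Modulo q the shift to the centred box is invisible, and the centred sum is exactly
  zero.\<close>

lemma sum_inverse_square_unit_box:
  assumes q: "q = 2 * h + 1" "int p dvd q"
  shows "p_cong p q (\<Sum>u\<in>unit_box p q. inverse (gauss_int u) ^ 2) 0"
proof -
  have "p_cong p q (\<Sum>u\<in>centered_box p h. inverse (gauss_int u + of_int q * box_shift u) ^ 2)
      (\<Sum>u\<in>centered_box p h. inverse (gauss_int u) ^ 2)"
  proof (rule p_cong_sum)
    fix u assume "u \<in> centered_box p h"
    then have u: "p_unit p u" by (simp add: centered_box_def)
    note t = translate_unit[OF u q(2), of "(of_bool (fst u \<le> 0), of_bool (snd u \<le> 0))",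
        folded box_shift_def]
    have "p_cong p q (gauss_int u + of_int q * box_shift u) (gauss_int u)"
      by (rule p_cong_diffI[OF box_shift_in[of u]]) simp
    then show "p_cong p q (inverse (gauss_int u + of_int q * box_shift u) ^ 2) (inverse (gauss_int u) ^ 2)"
      using t u by (intro p_cong_power2 p_cong_inverse inverse_gauss_int_in gauss_int_unit_nonzero)
  qed
  then show ?thesis
    using sum_unit_box_centered[OF q, of "\<lambda>z. inverse z ^ 2"]
    by (simp add: sum_inverse_square_centered_box)
qed

text \<open>Each 1/(u + q s) is expanded to second order in q. The constant terms cancel by
  symmetry, and the coefficient of q reduces to a sum over integers that supplies a second factor
  q.\<close>

lemma sum_inverse_unit_box:
  assumes q: "q = 2 * h + 1" "int p dvd q" "h \<ge> 0" and p3: "p \<noteq> 3"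
    and coprime: "\<And>x. q dvd 2 * x \<Longrightarrow> q dvd x"
  shows "p_cong p (q ^ 2) (\<Sum>u\<in>unit_box p q. inverse (gauss_int u)) 0"
proof -
  let ?B = "centered_box p h"
  let ?v = "\<lambda>u. inverse (gauss_int u)" and ?w = "\<lambda>u. inverse (gauss_int u + of_int q * box_shift u)"
  let ?r = "\<lambda>u. box_shift u ^ 2 * ?v u ^ 2 * ?w u"
  have unit: "p_unit p u" if "u \<in> ?B" for u
    using that by (simp add: centered_box_def)
  have expand: "?w u = ?v u - of_int q * (box_shift u * ?v u ^ 2) + of_int q ^ 2 * ?r u"
    and r_in: "?r u \<in> p_integral p" if "u \<in> ?B" for u
  proof -
    note t = translate_unit[OF unit[OF that] q(2), of "(of_bool (fst u \<le> 0), of_bool (snd u \<le> 0))",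
        folded box_shift_def]
    \<comment> \<open>An exact identity with remainder: with v and w the inverses of x and x + z,
      the relation w = v - z v w is substituted into itself once.\<close>
    have expansion: "inverse (x + z) = inverse x - z * inverse x ^ 2 + z ^ 2 * inverse x ^ 2 * inverse (x + z)"
      if "x \<noteq> 0" "x + z \<noteq> 0" for x z :: complex
    proof -
      have "w = v - z * v ^ 2 + z ^ 2 * v ^ 2 * w" if "v * x = 1" "w * (x + z) = 1" for v w
      proof -
        have "v = v * (w * (x + z))" using that(2) by simp
        also have "\<dots> = (v * x) * w + z * v * w" by (simp add: algebra_simps)
        finally have w: "v - z * v * w = w" by (simp add: that(1) diff_eq_eq)
        have "v - z * v ^ 2 + z ^ 2 * v ^ 2 * w = v - z * v * (v - z * v * w)"
          by (simp add: power2_eq_square algebra_simps)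
        then show ?thesis unfolding w by (rule sym)
      qed
      then show ?thesis using that by simp
    qed
    show "?w u = ?v u - of_int q * (box_shift u * ?v u ^ 2) + of_int q ^ 2 * ?r u"
      by (subst expansion) (use t gauss_int_unit_nonzero[OF unit[OF that]] in \<open>auto simp: power_mult_distrib\<close>)
    show "?r u \<in> p_integral p"
      using t inverse_gauss_int_in[OF unit[OF that]] by (intro mult_in power_in box_shift_in)
  qed
  obtain t where t: "t \<in> p_integral p"
    "(\<Sum>x | x \<in> {-h..h} \<and> \<not> int p dvd x. inverse (of_int x) ^ 2) = of_int q * t"
    using sum_inverse_squares[OF q p3 coprime] unfolding p_cong_def by auto
  have linear: "(\<Sum>u\<in>?B. box_shift u * ?v u ^ 2) = of_int q * ((\<i> - 1) * t / 2)"
    using sum_box_shift_inverse_square[of p h] t(2) by (simp add: mult_ac)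
  have total: "(\<Sum>u\<in>?B. ?w u)
      = (\<Sum>u\<in>?B. ?v u) - of_int q * (\<Sum>u\<in>?B. box_shift u * ?v u ^ 2) + of_int q ^ 2 * (\<Sum>u\<in>?B. ?r u)"
  proof -
    have "(\<Sum>u\<in>?B. ?w u) = (\<Sum>u\<in>?B. ?v u - of_int q * (box_shift u * ?v u ^ 2) + of_int q ^ 2 * ?r u)"
      by (rule sum.cong[OF refl expand])
    then show ?thesis by (simp only: sum.distrib sum_subtractf sum_distrib_left)
  qed
  have "(\<Sum>u\<in>?B. ?w u) - 0 = of_int (q ^ 2) * ((\<Sum>u\<in>?B. ?r u) - (\<i> - 1) * t / 2)"
    unfolding total linear sum_inverse_centered_box by (simp add: right_diff_distrib power2_eq_square)
  moreover have "(\<Sum>u\<in>?B. ?r u) - (\<i> - 1) * t / 2 \<in> p_integral p"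
    by (intro diff_in sum_in r_in half_in mult_in t i_in one_in)
  ultimately show ?thesis
    unfolding sum_unit_box_centered[OF q(1,2), of inverse] by (rule p_cong_diffI[rotated])
qed

text \<open>Here e is the second elementary symmetric polynomial of the v u, recorded through
  Newton's identity so that power sums control it; w collects everything from z^3 on.\<close>

lemma prod_one_plus:
  assumes "finite U" and v: "\<And>u. u \<in> U \<Longrightarrow> v u \<in> p_integral p" and z: "z \<in> p_integral p"
  shows "\<exists>e\<in>p_integral p. \<exists>w\<in>p_integral p. 2 * e = (\<Sum>u\<in>U. v u) ^ 2 - (\<Sum>u\<in>U. v u ^ 2) \<and>
    (\<Prod>u\<in>U. 1 + z * v u) = 1 + z * (\<Sum>u\<in>U. v u) + z ^ 2 * e + z ^ 3 * w"
  using assms(1) v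
proof (induction U)
  case empty
  then show ?case by (intro bexI[of _ 0]) (auto simp: zero_in)
next
  case (insert x U)
  let ?s = "\<Sum>u\<in>U. v u"
  obtain e w where e: "e \<in> p_integral p" "w \<in> p_integral p" "2 * e = ?s ^ 2 - (\<Sum>u\<in>U. v u ^ 2)"
    and eq: "(\<Prod>u\<in>U. 1 + z * v u) = 1 + z * ?s + z ^ 2 * e + z ^ 3 * w"
    using insert by auto
  have s: "?s \<in> p_integral p" and x: "v x \<in> p_integral p" using insert by (auto intro: sum_in)
  show ?case
  \<comment> \<open>The witnesses are the coefficients obtained on multiplying the old expansion by
    1 + z * v x.\<close>
  proof (rule bexI[of _ "e + ?s * v x"], rule bexI[of _ "w + e * v x + z * w * v x"], rule conjI)
    show "e + ?s * v x \<in> p_integral p" "w + e * v x + z * w * v x \<in> p_integral p"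
      using e s x z by (auto intro!: add_in mult_in)
    show "2 * (e + ?s * v x) = (\<Sum>u\<in>insert x U. v u) ^ 2 - (\<Sum>u\<in>insert x U. v u ^ 2)"
      using insert(1,2) e(3) by (simp add: power2_eq_square algebra_simps)
    show "(\<Prod>u\<in>insert x U. 1 + z * v u)
        = 1 + z * (\<Sum>u\<in>insert x U. v u) + z ^ 2 * (e + ?s * v x) + z ^ 3 * (w + e * v x + z * w * v x)"
      using insert(1,2) by (simp add: eq) (simp add: power2_eq_square power3_eq_cube algebra_simps)
  qed
qed

text \<open>The linear coefficient of the translate is divisible by \<open>q\<^sup>2\<close> and the quadratic one by \<open>q\<close>.\<close>
lemma prod_translate_unit_box:
  assumes q: "q = 2 * h + 1" "int p dvd q" "h \<ge> 0" and p3: "p \<noteq> 3"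
    and coprime: "\<And>x. q dvd 2 * x \<Longrightarrow> q dvd x"
  shows "p_cong p (q ^ 3) (\<Prod>u\<in>unit_box p q. gauss_int u + of_int q * gauss_int v)
    (\<Prod>u\<in>unit_box p q. gauss_int u)"
proof -
  let ?U = "unit_box p q"
  let ?t = "gauss_int v"
  let ?Q = "of_int q :: complex"
  have unit: "p_unit p u" if "u \<in> ?U" for u using that by (simp add: unit_box_def)
  obtain s where s: "s \<in> p_integral p" "(\<Sum>u\<in>?U. inverse (gauss_int u)) = ?Q ^ 2 * s"
    using sum_inverse_unit_box[OF assms] unfolding p_cong_def by auto
  obtain s2 where s2: "s2 \<in> p_integral p" "(\<Sum>u\<in>?U. inverse (gauss_int u) ^ 2) = ?Q * s2"
    using sum_inverse_square_unit_box[OF q(1,2)] unfolding p_cong_def by auto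
  obtain e w where w: "w \<in> p_integral p"
    and e: "2 * e = (\<Sum>u\<in>?U. inverse (gauss_int u)) ^ 2 - (\<Sum>u\<in>?U. inverse (gauss_int u) ^ 2)"
    and prod: "(\<Prod>u\<in>?U. 1 + (?Q * ?t) * inverse (gauss_int u))
      = 1 + (?Q * ?t) * (\<Sum>u\<in>?U. inverse (gauss_int u)) + (?Q * ?t) ^ 2 * e + (?Q * ?t) ^ 3 * w"
    using prod_one_plus[OF finite_unit_box, of p q "\<lambda>u. inverse (gauss_int u)" "?Q * ?t"]
      unit inverse_gauss_int_in by (metis gauss_int_in mult_in of_int_in)
  \<comment> \<open>The two power sums contribute q^4 s^2 and q s2, so one factor q comes out of e.
    Together with z^2 this makes q^3.\<close>
  have e': "e = ?Q * ((?Q ^ 3 * s ^ 2 - s2) / 2)"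
    using e unfolding s(2) s2(2) by (simp add: field_simps power2_eq_square power3_eq_cube)
  \<comment> \<open>The linear, quadratic and cubic terms of the expansion after q^3 has been taken
    out of each.\<close>
  define y where "y = ?t * s + ?t ^ 2 * ((?Q ^ 3 * s ^ 2 - s2) / 2) + ?t ^ 3 * w"
  have y: "y \<in> p_integral p" unfolding y_def
    by (intro add_in mult_in power_in half_in diff_in gauss_int_in of_int_in s s2 w)
  have "(\<Prod>u\<in>?U. gauss_int u + ?Q * ?t)
      = (\<Prod>u\<in>?U. gauss_int u * (1 + (?Q * ?t) * inverse (gauss_int u)))"
    using unit gauss_int_unit_nonzero by (intro prod.cong) (auto simp: field_simps)
  also have "\<dots> = (\<Prod>u\<in>?U. gauss_int u) * (1 + ?Q ^ 3 * y)"
    unfolding prod.distrib prod s(2) e' y_def by (simp add: power2_eq_square power3_eq_cube algebra_simps)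
  finally have "(\<Prod>u\<in>?U. gauss_int u + ?Q * ?t) - (\<Prod>u\<in>?U. gauss_int u)
      = of_int (q ^ 3) * ((\<Prod>u\<in>?U. gauss_int u) * y)"
    by (simp add: algebra_simps)
  then show ?thesis by (rule p_cong_diffI[rotated]) (intro mult_in prod_in gauss_int_in y)
qed

end

subsection \<open>Products over boxes\<close>

text \<open>With intervals open on the left, dividing the multiples of p in a box by p just takes
  floors of all four endpoints, and adjacent boxes do not overlap.\<close>

definition box :: "int \<Rightarrow> int \<Rightarrow> int \<Rightarrow> int \<Rightarrow> (int \<times> int) set" where
  "box a a' b b' = {a<..a'} \<times> {b<..b'}"

lemma finite_box [simp]: "finite (box a a' b b')"
  by (simp add: box_def)

lemma rect_gauss_binomial_box:
  "rect_gauss_binomial A B C D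
    = (\<Prod>u\<in>box (A - C) A (B - D) B. gauss_int u) / (\<Prod>u\<in>box 0 C 0 D. gauss_int u)"
proof -
  have "(\<Prod>x\<in>{a+1..a'}. \<Prod>y\<in>{b+1..b'}. of_int x + \<i> * of_int y) = (\<Prod>u\<in>box a a' b b'. gauss_int u)"
    for a a' b b'
  proof -
    have "{a+1..a'} = {a<..a'}" "{b+1..b'} = {b<..b'}" by auto
    then show ?thesis
      by (simp add: box_def prod.cartesian_product gauss_int_eq case_prod_beta' flip: gauss_int_eq)
  qed
  from this[where a = "A - C" and a' = A and b = "B - D" and b' = B]
    this[where a = 0 and a' = C and b = 0 and b' = D] show ?thesis
    by (simp add: rect_gauss_binomial_altdef)
qed

lemma box_mono: "a \<le> c \<Longrightarrow> c' \<le> a' \<Longrightarrow> b \<le> d \<Longrightarrow> d' \<le> b' \<Longrightarrow> box c c' d d' \<subseteq> box a a' b b'"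
  by (auto simp: box_def)

lemma prod_box_nonzero: "(\<Prod>u\<in>box 0 c 0 d. gauss_int u) \<noteq> 0"
  by (auto simp: box_def gauss_int_eq_0_iff)

text \<open>The points that are not units are p times the points of the box with floored endpoints,
  and each of them contributes one factor p.\<close>

lemma prod_box_split:
  assumes p: "p > 0"
  shows "(\<Prod>u\<in>box a a' b b'. gauss_int u) = (\<Prod>u | u \<in> box a a' b b' \<and> p_unit p u. gauss_int u)
    * (of_nat p ^ card (box (a div p) (a' div p) (b div p) (b' div p))
    * (\<Prod>u\<in>box (a div p) (a' div p) (b div p) (b' div p). gauss_int u))"
proof -
  let ?S = "box a a' b b'" and ?T = "box (a div p) (a' div p) (b div p) (b' div p)"
  have le: "int p * m \<le> c \<longleftrightarrow> m \<le> c div int p" for m c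
  proof
    assume "int p * m \<le> c"
    then have "int p * m div int p \<le> c div int p" using p by (intro zdiv_mono1) auto
    then show "m \<le> c div int p" using p by simp
  next
    assume "m \<le> c div int p"
    then have "int p * m \<le> int p * (c div int p)" by (rule mult_left_mono) simp
    then show "int p * m \<le> c"
      using p pos_mod_sign[of "int p" c] mult_div_mod_eq[of "int p" c] by linarith
  qed
  \<comment> \<open>The upper bounds satisfy \<open>le\<close> directly, the strict lower bounds
    after negation.\<close>
  have mem: "(int p * m, int p * n) \<in> ?S \<longleftrightarrow> (m, n) \<in> ?T" for m n
    by (auto simp: box_def le simp flip: not_le)
  have "(\<Prod>u\<in>?S. gauss_int u) = (\<Prod>u | u \<in> ?S \<and> p_unit p u. gauss_int u)
      * (\<Prod>u | u \<in> ?S \<and> \<not> p_unit p u. gauss_int u)"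
    by (subst prod.union_disjoint[symmetric]) (auto intro!: prod.cong)
  also have "(\<Prod>u | u \<in> ?S \<and> \<not> p_unit p u. gauss_int u) = (\<Prod>u\<in>?T. of_nat p * gauss_int u)"
  proof (rule prod.reindex_bij_witness[where i = "\<lambda>u. (int p * fst u, int p * snd u)"
        and j = "\<lambda>u. (fst u div int p, snd u div int p)"])
    fix u
    {
      assume "u \<in> {u. u \<in> ?S \<and> \<not> p_unit p u}"
      then have "u \<in> ?S" "int p dvd fst u" "int p dvd snd u" by (auto simp: p_unit_def)
      moreover from this obtain m n where "u = (int p * m, int p * n)"
        by (metis dvdE prod.collapse)
      ultimately have "u \<in> ?S" "u = (int p * m, int p * n)" by blast+
      then show "(int p * fst (fst u div int p, snd u div int p), int p * snd (fst u div int p, snd u div int p)) = u"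
        "(fst u div int p, snd u div int p) \<in> ?T"
        "of_nat p * gauss_int (fst u div int p, snd u div int p) = gauss_int u"
        using mem p by (simp_all add: gauss_int_def complex_eq_iff)
    }
  qed (use mem p in \<open>auto simp: p_unit_def\<close>)
  also have "\<dots> = of_nat p ^ card ?T * (\<Prod>u\<in>?T. gauss_int u)"
    by (simp add: prod.distrib)
  finally show ?thesis .
qed

text \<open>Division with remainders 1, ..., q writes every point uniquely as q v + u; since p
  divides q, the point is a unit exactly when u is.\<close>

lemma prod_unit_box_tiling:
  assumes q: "q > 0" "int p dvd q"
  shows "(\<Prod>u | u \<in> box (q * a) (q * a') (q * b) (q * b') \<and> p_unit p u. gauss_int u)
    = (\<Prod>v\<in>{a..<a'} \<times> {b..<b'}. \<Prod>u\<in>unit_box p q. gauss_int u + of_int q * gauss_int v)"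
proof -
  let ?S = "{u. u \<in> box (q * a) (q * a') (q * b) (q * b') \<and> p_unit p u}"
  have tile: "\<exists>j y. x = q * j + y \<and> 0 < y \<and> y \<le> q" for x
  proof -
    have "x = q * ((x - 1) div q) + ((x - 1) mod q + 1)"
      using mult_div_mod_eq[of q "x - 1"] by simp
    moreover have "0 < (x - 1) mod q + 1" "(x - 1) mod q + 1 \<le> q"
      using q(1) pos_mod_bound[of q "x - 1"] pos_mod_sign[of q "x - 1"] by linarith+
    ultimately show ?thesis by blast
  qed
  \<comment> \<open>Remainders start at 1, so the tile index is recovered by dividing x - 1. This
    gives injectivity below.\<close>
  have div: "(q * j + y - 1) div q = j" if "0 < y" "y \<le> q" for j y
    using that by (intro int_div_pos_eq[of _ _ _ "y - 1"]) auto
  have mem: "q * c < q * j + y \<and> q * j + y \<le> q * c' \<longleftrightarrow> c \<le> j \<and> j < c'" if "0 < y" "y \<le> q" for c c' j y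
  proof -
    have "q * c < q * j + y \<longleftrightarrow> c \<le> j"
    proof
      assume "c \<le> j"
      then have "q * c \<le> q * j" using q by simp
      then show "q * c < q * j + y" using that by linarith
    next
      assume *: "q * c < q * j + y"
      show "c \<le> j"
      proof (rule ccontr)
        assume "\<not> c \<le> j"
        then have "q * (j + 1) \<le> q * c" using q by (intro mult_left_mono) auto
        from this[unfolded distrib_left] show False using * that by linarith
      qed
    qed
    moreover have "q * j + y \<le> q * c' \<longleftrightarrow> j < c'"
    proof
      assume "j < c'"
      then have "q * (j + 1) \<le> q * c'" using q by (intro mult_left_mono) auto
      from this[unfolded distrib_left] show "q * j + y \<le> q * c'" using that by linarith
    next
      assume *: "q * j + y \<le> q * c'"
      show "j < c'"
      proof (rule ccontr)
        assume "\<not> j < c'"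
        then have "q * c' \<le> q * j" using q by simp
        then show False using * that by linarith
      qed
    qed
    ultimately show ?thesis by simp
  qed
  have dvd: "int p dvd q * j + y \<longleftrightarrow> int p dvd y" for j y
    using q(2) by (simp add: dvd_add_right_iff)
  let ?i = "\<lambda>(v, u). (q * fst v + fst u, q * snd v + snd u)"
  have "bij_betw ?i (({a..<a'} \<times> {b..<b'}) \<times> unit_box p q) ?S"
    unfolding bij_betw_def
  proof
    show "inj_on ?i (({a..<a'} \<times> {b..<b'}) \<times> unit_box p q)"
    proof (rule inj_onI)
      fix w w'
      assume "w \<in> ({a..<a'} \<times> {b..<b'}) \<times> unit_box p q" "w' \<in> ({a..<a'} \<times> {b..<b'}) \<times> unit_box p q"
        and eq: "?i w = ?i w'"
      moreover obtain j l x y where w: "w = ((j, l), (x, y))" by (metis surj_pair)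
      moreover obtain j' l' x' y' where w': "w' = ((j', l'), (x', y'))" by (metis surj_pair)
      ultimately have u: "(x, y) \<in> unit_box p q" "(x', y') \<in> unit_box p q" by auto
      from eq w w' have eq: "q * j + x = q * j' + x'" "q * l + y = q * l' + y'" by simp_all
      have "j = j'" "l = l'"
        using div[of x j] div[of x' j'] div[of y l] div[of y' l'] u eq
        by (auto simp: unit_box_def)
      then show "w = w'" using eq w w' by simp
    qed
    show "?i ` (({a..<a'} \<times> {b..<b'}) \<times> unit_box p q) = ?S"
    proof
      show "?i ` (({a..<a'} \<times> {b..<b'}) \<times> unit_box p q) \<subseteq> ?S"
        by (clarsimp simp: unit_box_def box_def p_unit_def dvd mem)
      show "?S \<subseteq> ?i ` (({a..<a'} \<times> {b..<b'}) \<times> unit_box p q)"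
      proof
        fix u assume u: "u \<in> ?S"
        obtain j x where x: "fst u = q * j + x" "0 < x" "x \<le> q" using tile by metis
        obtain l y where y: "snd u = q * l + y" "0 < y" "y \<le> q" using tile by metis
        have "((j, l), (x, y)) \<in> ({a..<a'} \<times> {b..<b'}) \<times> unit_box p q"
          using u x y mem[of x a j a'] mem[of y b l b']
          by (cases u) (auto simp: unit_box_def box_def p_unit_def dvd)
        moreover have "u = ?i ((j, l), (x, y))" using x y by (simp add: prod_eq_iff)
        ultimately show "u \<in> ?i ` (({a..<a'} \<times> {b..<b'}) \<times> unit_box p q)" by blast
      qed
    qed
  qed
  then have "(\<Prod>u\<in>?S. gauss_int u)
      = (\<Prod>w\<in>({a..<a'} \<times> {b..<b'}) \<times> unit_box p q. gauss_int (?i w))"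
    by (rule prod.reindex_bij_betw[symmetric])
  also have "\<dots> = (\<Prod>(v, u)\<in>({a..<a'} \<times> {b..<b'}) \<times> unit_box p q. gauss_int u + of_int q * gauss_int v)"
    by (intro prod.cong) (auto simp: gauss_int_def complex_eq_iff)
  finally show ?thesis by (simp only: prod.cartesian_product)
qed

section \<open>Integrality of the binomial and the congruence in the local ring\<close>

context inert_prime
begin

lemma of_nat_in: "of_nat n \<in> p_integral p"
  using of_int_in[of "int n"] by simp

lemma inverse_prod_units_in:
  assumes "\<And>u. u \<in> S \<Longrightarrow> p_unit p u"
  shows "inverse (\<Prod>u\<in>S. gauss_int u) \<in> p_integral p" "(\<Prod>u\<in>S. gauss_int u) \<noteq> 0"
proof -
  show "inverse (\<Prod>u\<in>S. gauss_int u) \<in> p_integral p"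
    unfolding prod_inversef[symmetric] comp_def using assms inverse_gauss_int_in by (intro prod_in) auto
  show "(\<Prod>u\<in>S. gauss_int u) \<noteq> 0"
    using assms gauss_int_unit_nonzero by (cases "finite S") (auto simp: prod_zero_iff)
qed

text \<open>
  An interval of length \<open>c\<close> contains at least \<open>c div p\<close> multiples of \<open>p\<close>; dividing these by \<open>p\<close>
  leaves a box of the same kind.
\<close>
lemma prod_box_divisible:
  assumes "c \<ge> 0" "d \<ge> 0"
  shows "\<exists>w\<in>p_integral p. (\<Prod>u\<in>box a (a + c) b (b + d). gauss_int u) = w * (\<Prod>u\<in>box 0 c 0 d. gauss_int u)"
  using assms
\<comment> \<open>Only c is certain to decrease, since \<open>c div p < c\<close> for positive c,
  whereas d may be 0 and stay so.\<close>
proof (induction "nat c" arbitrary: a b c d rule: less_induct)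
  case less
  show ?case
  proof (cases "c = 0")
    case True
    then show ?thesis by (intro bexI[of _ 1]) (auto simp: box_def one_in)
  next
    case False
    let ?P = "int p"
    have p1: "?P > 1" using prime_gt_1_nat[OF prime_p] by simp
    have c: "c > 0" using False less.prems by simp
    have div_c: "0 \<le> c div ?P" "c div ?P < c" "0 \<le> d div ?P"
      using c p1 less.prems by (auto simp: pos_imp_zdiv_nonneg_iff int_div_less_self)
    \<comment> \<open>Floors are superadditive, so the floored box \<open>?B'\<close> contains the
      box \<open>?B\<close> to which the induction hypothesis applies.\<close>
    have superadd: "x div ?P + y div ?P \<le> (x + y) div ?P" for x y
      using p1 by (subst div_add1_eq) (simp add: pos_imp_zdiv_nonneg_iff)
    let ?B = "box (a div ?P) (a div ?P + c div ?P) (b div ?P) (b div ?P + d div ?P)"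
    let ?B' = "box (a div ?P) ((a + c) div ?P) (b div ?P) ((b + d) div ?P)"
    let ?Bz = "box 0 (c div ?P) 0 (d div ?P)"
    obtain w where w: "w \<in> p_integral p" "(\<Prod>u\<in>?B. gauss_int u) = w * (\<Prod>u\<in>?Bz. gauss_int u)"
      using less.hyps[of "c div ?P" "d div ?P" "a div ?P" "b div ?P", OF _ div_c(1,3)] div_c(2) c
      by (metis nat_mono_iff)
    have sub: "?B \<subseteq> ?B'" using superadd by (intro box_mono) auto
    have B': "(\<Prod>u\<in>?B'. gauss_int u) = (\<Prod>u\<in>?B' - ?B. gauss_int u) * (w * (\<Prod>u\<in>?Bz. gauss_int u))"
      using prod.subset_diff[OF sub finite_box, of gauss_int] w(2) by simp
    have card: "card ?Bz \<le> card ?B'"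
    proof -
      have "card ?Bz = card ?B" by (simp add: box_def card_cartesian_product)
      then show ?thesis using card_mono[OF finite_box sub] by simp
    qed
    let ?U = "{u. u \<in> box a (a + c) b (b + d) \<and> p_unit p u}" and ?Uz = "{u. u \<in> box 0 c 0 d \<and> p_unit p u}"
    \<comment> \<open>The quotient of the two products: the ratio of unit parts, the surplus power
      of p, the points of \<open>?B'\<close> outside \<open>?B\<close>, and the inductive
      factor.\<close>
    let ?w = "(\<Prod>u\<in>?U. gauss_int u) * inverse (\<Prod>u\<in>?Uz. gauss_int u)
      * (of_nat p ^ (card ?B' - card ?Bz) * (\<Prod>u\<in>?B' - ?B. gauss_int u) * w)"
    have "(\<Prod>u\<in>box a (a + c) b (b + d). gauss_int u)
        = (\<Prod>u\<in>?U. gauss_int u) * (of_nat p ^ card ?B' * (\<Prod>u\<in>?B'. gauss_int u))"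
      by (rule prod_box_split[OF p_pos])
    also have "\<dots> = ?w * ((\<Prod>u\<in>?Uz. gauss_int u) * (of_nat p ^ card ?Bz * (\<Prod>u\<in>?Bz. gauss_int u)))"
    proof -
      have "of_nat p ^ card ?B' = (of_nat p ^ (card ?B' - card ?Bz) * of_nat p ^ card ?Bz :: complex)"
        using card by (simp flip: power_add)
      moreover have "inverse (\<Prod>u\<in>?Uz. gauss_int u) * (\<Prod>u\<in>?Uz. gauss_int u) = 1"
        using inverse_prod_units_in(2)[of ?Uz] by simp
      moreover have "x * (m * (r * (y * z))) = x * i * (k * r * y) * (v * (n * z))"
        if "m = k * n" "i * v = 1" for x m r y z i k v n :: complex
      proof -
        have "x * i * (k * r * y) * (v * (n * z)) = (i * v) * (x * (k * n * (r * (y * z))))"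
          by (simp only: mult_ac)
        then show ?thesis using that by simp
      qed
      ultimately show ?thesis unfolding B' by blast
    qed
    also have "(\<Prod>u\<in>?Uz. gauss_int u) * (of_nat p ^ card ?Bz * (\<Prod>u\<in>?Bz. gauss_int u))
        = (\<Prod>u\<in>box 0 c 0 d. gauss_int u)"
      using prod_box_split[OF p_pos, of 0 c 0 d] by simp
    finally have "(\<Prod>u\<in>box a (a + c) b (b + d). gauss_int u) = ?w * (\<Prod>u\<in>box 0 c 0 d. gauss_int u)" .
    moreover have "?w \<in> p_integral p"
      using inverse_prod_units_in(1)[of ?Uz] w(1)
      by (intro mult_in prod_in power_in gauss_int_in of_nat_in) auto
    ultimately show ?thesis by blast
  qed
qed

text \<open>Integrality at the lower level allows a congruence between unit products to be
  multiplied by that binomial.\<close>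

lemma rect_gauss_binomial_p_integral:
  assumes "C \<ge> 0" "D \<ge> 0"
  shows "rect_gauss_binomial A B C D \<in> p_integral p"
proof -
  obtain w where "w \<in> p_integral p"
    "(\<Prod>u\<in>box (A - C) A (B - D) B. gauss_int u) = w * (\<Prod>u\<in>box 0 C 0 D. gauss_int u)"
    using prod_box_divisible[OF assms, of "A - C" "B - D"] by auto
  then show ?thesis using prod_box_nonzero[of C D] by (simp add: rect_gauss_binomial_box)
qed

text \<open>Every tile has the same product modulo q^3 as the block at the origin, and both boxes
  consist of equally many tiles.\<close>

lemma prod_units_box_cong:
  assumes q: "q = 2 * h + 1" "int p dvd q" "h \<ge> 0" and p3: "p \<noteq> 3"
    and coprime: "\<And>x. q dvd 2 * x \<Longrightarrow> q dvd x"
  shows "p_cong p (q ^ 3) (\<Prod>u | u \<in> box (q * (A - C)) (q * A) (q * (B - D)) (q * B) \<and> p_unit p u. gauss_int u)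
    (\<Prod>u | u \<in> box 0 (q * C) 0 (q * D) \<and> p_unit p u. gauss_int u)"
proof -
  let ?P = "\<Prod>u\<in>unit_box p q. gauss_int u"
  have "q > 0" using q by simp
  have *: "p_cong p (q ^ 3) (\<Prod>u | u \<in> box (q * a) (q * a') (q * b) (q * b') \<and> p_unit p u. gauss_int u)
    (?P ^ card ({a..<a'} \<times> {b..<b'}))" for a a' b b'
  proof -
    have "p_cong p (q ^ 3) (\<Prod>v\<in>{a..<a'} \<times> {b..<b'}. \<Prod>u\<in>unit_box p q. gauss_int u + of_int q * gauss_int v)
        (\<Prod>v\<in>{a..<a'} \<times> {b..<b'}. ?P)"
      by (intro p_cong_prod prod_translate_unit_box[OF q p3 coprime] prod_in add_in mult_in
          gauss_int_in of_int_in)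
    then show ?thesis
      using prod_unit_box_tiling[OF \<open>q > 0\<close> q(2)] by simp
  qed
  show ?thesis
    using *[of "A - C" A "B - D" B] *[of 0 C 0 D]
    by (auto simp: card_cartesian_product intro: p_cong_trans p_cong_sym)
qed

lemma rect_gauss_binomial_p_cong:
  assumes p3: "p \<noteq> 3" and k: "k \<ge> 1" and "C \<ge> 0" "D \<ge> 0"
  shows "p_cong p ((int p ^ k) ^ 3)
    (rect_gauss_binomial (int p ^ k * A) (int p ^ k * B) (int p ^ k * C) (int p ^ k * D))
    (rect_gauss_binomial (int p ^ (k - 1) * A) (int p ^ (k - 1) * B)
                         (int p ^ (k - 1) * C) (int p ^ (k - 1) * D))"
proof -
  define q where "q = int p ^ k"
  define r where "r = int p ^ (k - 1)"
  have qr: "q = int p * r" unfolding q_def r_def using k by (cases k) auto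
  have odd_p: "odd (int p)" using p_mod_4 by presburger
  then have "odd q" by (simp add: q_def)
  then obtain h where h: "q = 2 * h + 1" by (rule oddE)
  have "q > 0" using p_pos by (simp add: q_def)
  then have h0: "h \<ge> 0" using h by simp
  \<comment> \<open>Oddness of q serves twice: it provides the centre h and permits cancelling 2
    modulo q.\<close>
  have "coprime q 2" using \<open>odd q\<close> by simp
  then have coprime: "q dvd x" if "q dvd 2 * x" for x
    using that by (simp add: coprime_dvd_mult_right_iff)
  let ?U = "\<Prod>u | u \<in> box (q * (A - C)) (q * A) (q * (B - D)) (q * B) \<and> p_unit p u. gauss_int u"
  let ?V = "\<Prod>u | u \<in> box 0 (q * C) 0 (q * D) \<and> p_unit p u. gauss_int u"
  let ?R = "rect_gauss_binomial (r * A) (r * B) (r * C) (r * D)"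
  have pd: "int p dvd q" by (simp add: qr)
  obtain w where w: "w \<in> p_integral p" "?U - ?V = of_int (q ^ 3) * w"
    using prod_units_box_cong[OF h pd h0 p3 coprime] unfolding p_cong_def by blast
  have V: "inverse ?V \<in> p_integral p" "?V \<noteq> 0"
    by (rule inverse_prod_units_in; simp)+
  \<comment> \<open>All endpoints are multiples of q, so the floors are exact and the split produces
    precisely the boxes of level k - 1.\<close>
  have div: "q * x div int p = r * x" for x using p_pos by (simp add: qr mult.assoc)
  have split: "(\<Prod>u\<in>box (q * a) (q * a') (q * b) (q * b'). gauss_int u)
      = (\<Prod>u | u \<in> box (q * a) (q * a') (q * b) (q * b') \<and> p_unit p u. gauss_int u)
      * (of_nat p ^ card (box (r * a) (r * a') (r * b) (r * b')) * (\<Prod>u\<in>box (r * a) (r * a') (r * b) (r * b'). gauss_int u))"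
    for a a' b b'
    using prod_box_split[OF p_pos, of "q * a" "q * a'" "q * b" "q * b'"] by (simp only: div)
  \<comment> \<open>Equal side lengths make the powers of p in numerator and denominator
    cancel.\<close>
  have card: "card (box (r * (A - C)) (r * A) (r * (B - D)) (r * B)) = card (box 0 (r * C) 0 (r * D))"
    by (simp add: box_def card_cartesian_product algebra_simps)
  have "rect_gauss_binomial (q * A) (q * B) (q * C) (q * D) = ?U * inverse ?V * ?R"
  proof -
    have cancel: "(x * (m * y)) / (v * (m * z)) = x * inverse v * (y / z)" if "m \<noteq> 0" for x m y v z :: complex
      using that by (simp add: divide_inverse)
    \<comment> \<open>The lower endpoints are written as \<open>q * 0\<close> so that
      \<open>split\<close> applies to the denominator too.\<close>
    have "rect_gauss_binomial (q * A) (q * B) (q * C) (q * D)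
        = (\<Prod>u\<in>box (q * (A - C)) (q * A) (q * (B - D)) (q * B). gauss_int u)
        / (\<Prod>u\<in>box (q * 0) (q * C) (q * 0) (q * D). gauss_int u)"
      by (simp add: rect_gauss_binomial_box right_diff_distrib)
    also have "\<dots> = ?U * inverse ?V * ((\<Prod>u\<in>box (r * (A - C)) (r * A) (r * (B - D)) (r * B). gauss_int u)
        / (\<Prod>u\<in>box (r * 0) (r * C) (r * 0) (r * D). gauss_int u))"
      unfolding split using card p_pos by (simp add: cancel)
    also have "\<dots> = ?U * inverse ?V * ?R"
      by (simp add: rect_gauss_binomial_box right_diff_distrib)
    finally show ?thesis .
  qed
  \<comment> \<open>Since \<open>?V\<close> is nonzero, (U / V) R - R = (U - V) V^-1 R, where V^-1
    and R are both integral at p.\<close>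
  then have "rect_gauss_binomial (q * A) (q * B) (q * C) (q * D) - ?R = (?U - ?V) * (inverse ?V * ?R)"
    using V(2) by (simp add: algebra_simps)
  also have "\<dots> = of_int (q ^ 3) * (w * (inverse ?V * ?R))"
    by (simp add: w(2))
  finally show ?thesis
    unfolding q_def[symmetric] r_def[symmetric]
  proof (rule p_cong_diffI[rotated])
    have "r \<ge> 0" by (simp add: r_def)
    then have "?R \<in> p_integral p" using assms by (intro rect_gauss_binomial_p_integral) auto
    then show "w * (inverse ?V * ?R) \<in> p_integral p" by (intro mult_in w V)
  qed
qed

end

subsection \<open>From local congruences to the completion\<close>

lemma p_integral_Complex:
  assumes "prime p" "z \<in> p_integral p"
  obtains x y where "z = Complex (of_rat x) (of_rat y)" "padic_abs p x \<le> 1" "padic_abs p y \<le> 1"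
proof -
  obtain a b n where n: "\<not> int p dvd n" "z = gauss_int (a, b) / of_int n"
    using assms(2) unfolding p_integral_def by blast
  have "z = Complex (of_rat (of_int a / of_int n)) (of_rat (of_int b / of_int n))"
    using n by (simp add: gauss_int_def complex_eq_iff of_rat_divide)
  then show ?thesis using padic_abs_le_1[OF assms(1) n(1)] that by blast
qed

text \<open>The image of the integral quotient w under the embedding is the element of
  \<open>Zpi p\<close> required: its rational coordinates have p-adic absolute value at most
  1.\<close>

lemma gauss_cong_if_p_cong:
  assumes p: "prime p" and X: "X \<in> gauss_rats" and Y: "Y \<in> gauss_rats"
    and cong: "p_cong p (int p ^ r) X Y"
  shows "gauss_cong p r X Y"
proof -
  obtain w where w: "w \<in> p_integral p" "X - Y = of_int (int p ^ r) * w"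
    using cong unfolding p_cong_def by blast
  obtain x y where xy: "w = Complex (of_rat x) (of_rat y)" "padic_abs p x \<le> 1" "padic_abs p y \<le> 1"
    using p_integral_Complex[OF p w(1)] by blast
  let ?c = "of_nat p ^ r :: rat"
  \<comment> \<open>In this form the coordinates of p^r are visibly rational, as the embedding
    lemmas require.\<close>
  have scalar: "of_nat p ^ r = Complex (of_rat ?c) 0"
  proof -
    have "Complex (of_rat ?c) 0 = of_real (of_rat ?c)" by (simp add: complex_eq_iff)
    then show ?thesis by (simp add: of_rat_power)
  qed
  have "X - Y = of_nat p ^ r * w" by (simp add: w(2))
  then have diff: "X - Y = Complex (of_rat (?c * x)) (of_rat (?c * y))"
    unfolding scalar xy(1) by (simp add: complex_eq_iff of_rat_mult)
  have "Qpi_of_gauss p w \<in> Zpi p"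
    using xy Qp_of_rat_closed[OF p] Qp_norm_Qp_of_rat[OF p]
    by (simp add: Qpi_of_gauss_Complex Zpi_def Zp_def)
  moreover have "Qpi_of_gauss p (X - Y) = Qpi_of_gauss p (of_nat p ^ r) \<otimes>\<^bsub>Qpi p\<^esub> Qpi_of_gauss p w"
    unfolding diff scalar xy(1) by (rule Qpi_of_gauss_scale[OF p])
  ultimately show ?thesis using X Y unfolding gauss_cong_def by blast
qed

theorem theorem1p2:
  fixes p k :: nat and A B C D :: int
  assumes "prime p" and "p > 5" and "p mod 4 = 3" and "k \<ge> 1"
    and "C \<ge> 1" and "A \<ge> C" and "D \<ge> 1" and "B \<ge> D"
  shows "gauss_cong p (3 * k)
    (rect_gauss_binomial (int p ^ k * A) (int p ^ k * B) (int p ^ k * C) (int p ^ k * D))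
    (rect_gauss_binomial (int p ^ (k - 1) * A) (int p ^ (k - 1) * B)
                         (int p ^ (k - 1) * C) (int p ^ (k - 1) * D))"
proof -
  interpret inert_prime p using assms by unfold_locales
  have "(int p ^ k) ^ 3 = int p ^ (3 * k)" by (simp add: mult.commute flip: power_mult)
  then show ?thesis
    using rect_gauss_binomial_p_cong[of k C D A B] assms
    by (intro gauss_cong_if_p_cong rect_gauss_binomial_in_gauss_rats) auto
qed

end
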